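(* Let $(\otimes,\mathrm{hom}_\ell,\mathrm{hom}_r)\colon\mathcal K\times\mathcal M\to\mathcal N$ and $(\otimes',\mathrm{hom}'_\ell,\mathrm{hom}'_r)\colon\mathcal K'\times\mathcal M'\to\mathcal N'$ be two-variable adjunctions, and let $K\colon\mathcal K\to\mathcal K'$, $M\colon\mathcal M\to\mathcal M'$, $N\colon\mathcal N\to\mathcal N'$ be functors. Then there is a bijective correspondence between natural transformations (each natural in both of its variables) $$\lambda_{k,m}\colon Kk\otimes' Mm\to N(k\otimes m),$$ $$\rho^\ell_{k,n}\colon M\,\mathrm{hom}_\ell(k,n)\to\mathrm{hom}'_\ell(Kk,Nn),$$ $$\rho^r_{m,n}\colon K\,\mathrm{hom}_r(m,n)\to\mathrm{hom}'_r(Mm,Nn),$$ obtained by applying the pointwise mates correspondence to either variable. That is, $\lambda$ and $\rho^\ell$ correspond by taking mates for each fixed $k\in\mathcal K$, $\lambda$ and $\rho^r$ correspond by taking mates for each fixed $m\in\mathcal M$, $\rho^\ell$ and $\rho^r$ correspond by taking mates for each fixed $n\in\mathcal N$, and these three bijections are compatible.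
   Context: A two-variable adjunction $(\otimes,\mathrm{hom}_\ell,\mathrm{hom}_r)\colon\mathcal K\times\mathcal M\to\mathcal N$ consists of bifunctors $\otimes\colon\mathcal K\times\mathcal M\to\mathcal N$, $\mathrm{hom}_\ell\colon\mathcal K^{\mathrm{op}}\times\mathcal N\to\mathcal M$, $\mathrm{hom}_r\colon\mathcal M^{\mathrm{op}}\times\mathcal N\to\mathcal K$ with isomorphisms $\mathcal N(k\otimes m,n)\cong\mathcal M(m,\mathrm{hom}_\ell(k,n))\cong\mathcal K(k,\mathrm{hom}_r(m,n))$ natural in all three variables. Fixing a variable gives adjunctions $k\otimes-\dashv\mathrm{hom}_\ell(k,-)$, $-\otimes m\dashv\mathrm{hom}_r(m,-)$, and $\mathrm{hom}_\ell(-,n)\colon\mathcal K\rightleftarrows\mathcal M^{\mathrm{op}}\colon\mathrm{hom}_r(-,n)$. Mates: given adjunctions $T\dashv S\colon\mathcal A\rightleftarrows\mathcal B$ (unit $\eta$, counit $\epsilon$) and $T'\dashv S'\colon\mathcal A'\rightleftarrows\mathcal B'$ (unit $\iota$, counit $\nu$) and functors $H\colon\mathcal A\to\mathcal A'$, $G\colon\mathcal B\to\mathcal B'$, natural transformations $\lambda\colon T'H\Rightarrow GT$ and $\rho\colon HS\Rightarrow S'G$ are mates if $\rho=S'G\epsilon\cdot S'\lambda_S\cdot\iota_{HS}$, equivalently $\lambda=\nu_{GT}\cdot T'\rho_T\cdot T'H\eta$; this is a bijection. Pointwise mates: $\lambda_{k,-}$ and $\rho^\ell_{k,-}$ are mates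 with respect to $k\otimes-\dashv\mathrm{hom}_\ell(k,-)$ and $Kk\otimes'-\dashv\mathrm{hom}'_\ell(Kk,-)$; $\lambda_{-,m}$ and $\rho^r_{m,-}$ are mates with respect to $-\otimes m\dashv\mathrm{hom}_r(m,-)$ and $-\otimes' Mm\dashv\mathrm{hom}'_r(Mm,-)$; $\rho^\ell_{-,n}$ (viewed as a transformation $\mathrm{hom}'_\ell(K-,Nn)\Rightarrow M^{\mathrm{op}}\mathrm{hom}_\ell(-,n)$ of functors $\mathcal K\to\mathcal M'^{\mathrm{op}}$) and $\rho^r_{-,n}$ are mates with respect to $\mathrm{hom}_\ell(-,n)\dashv\mathrm{hom}_r(-,n)$ and $\mathrm{hom}'_\ell(-,Nn)\dashv\mathrm{hom}'_r(-,Nn)$. *)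

theory Defs
  imports Main "HOL-Library.FuncSet"
begin

section \<open>Categories\<close>

record ('o, 'a) cat =
  Obj :: "'o set"
  Arr :: "'a set"
  Dom :: "'a \<Rightarrow> 'o"
  Cod :: "'a \<Rightarrow> 'o"
  Ident :: "'o \<Rightarrow> 'a"
  Comp :: "'a \<Rightarrow> 'a \<Rightarrow> 'a"  (infixr "\<cdot>\<index>" 70)

definition Hom :: "('o, 'a) cat \<Rightarrow> 'o \<Rightarrow> 'o \<Rightarrow> 'a set" where
  "Hom C a b = {f \<in> Arr C. Dom C f = a \<and> Cod C f = b}"

locale category =
  fixes C :: "('o, 'a) cat" (structure)
  assumes Dom_Obj: "f \<in> Arr C \<Longrightarrow> Dom C f \<in> Obj C"
    and Cod_Obj: "f \<in> Arr C \<Longrightarrow> Cod C f \<in> Obj C"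
    and Ident_Hom: "a \<in> Obj C \<Longrightarrow> Ident C a \<in> Hom C a a"
    and Comp_Hom: "\<lbrakk>f \<in> Hom C a b; g \<in> Hom C b c\<rbrakk> \<Longrightarrow> g \<cdot> f \<in> Hom C a c"
    and Comp_Ident: "f \<in> Hom C a b \<Longrightarrow> f \<cdot> Ident C a = f"
    and Ident_Comp: "f \<in> Hom C a b \<Longrightarrow> Ident C b \<cdot> f = f"
    and Comp_assoc:
      "\<lbrakk>f \<in> Hom C a b; g \<in> Hom C b c; h \<in> Hom C c d\<rbrakk> \<Longrightarrow> (h \<cdot> g) \<cdot> f = h \<cdot> (g \<cdot> f)"

definition op_cat :: "('o, 'a) cat \<Rightarrow> ('o, 'a) cat" where
  "op_cat C = \<lparr>Obj = Obj C, Arr = Arr C, Dom = Cod C, Cod = Dom C, Ident = Ident C,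
     Comp = (\<lambda>g f. f \<cdot>\<^bsub>C\<^esub> g)\<rparr>"

definition prod_cat :: "('o, 'a) cat \<Rightarrow> ('p, 'b) cat \<Rightarrow> ('o \<times> 'p, 'a \<times> 'b) cat" where
  "prod_cat C D = \<lparr>Obj = Obj C \<times> Obj D, Arr = Arr C \<times> Arr D,
     Dom = map_prod (Dom C) (Dom D), Cod = map_prod (Cod C) (Cod D),
     Ident = map_prod (Ident C) (Ident D),
     Comp = (\<lambda>(g, g') (f, f'). (g \<cdot>\<^bsub>C\<^esub> f, g' \<cdot>\<^bsub>D\<^esub> f'))\<rparr>"


section \<open>Functors and natural transformations\<close>

text \<open>The source and target categories are not part of the data of a functor.  In particular
  the opposite \<open>C\<^sup>o\<^sup>p \<rightarrow> D\<^sup>o\<^sup>p\<close> of a functor \<open>C \<rightarrow> D\<close> is given by the same record.\<close>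

record ('o, 'a, 'p, 'b) fnctr =
  fob :: "'o \<Rightarrow> 'p"
  far :: "'a \<Rightarrow> 'b"

locale is_functor = src: category C + tgt: category D
  for C :: "('o, 'a) cat" and D :: "('p, 'b) cat" and F :: "('o, 'a, 'p, 'b) fnctr" +
  assumes fob_Obj: "a \<in> Obj C \<Longrightarrow> fob F a \<in> Obj D"
    and far_Hom: "f \<in> Hom C a b \<Longrightarrow> far F f \<in> Hom D (fob F a) (fob F b)"
    and far_Ident: "a \<in> Obj C \<Longrightarrow> far F (Ident C a) = Ident D (fob F a)"
    and far_Comp:
      "\<lbrakk>f \<in> Hom C a b; g \<in> Hom C b c\<rbrakk> \<Longrightarrow> far F (g \<cdot>\<^bsub>C\<^esub> f) = far F g \<cdot>\<^bsub>D\<^esub> far F f"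

definition id_fnctr :: "('o, 'a, 'o, 'a) fnctr" where
  "id_fnctr = \<lparr>fob = (\<lambda>a. a), far = (\<lambda>f. f)\<rparr>"

definition comp_fnctr ::
  "('p, 'b, 'q, 'c) fnctr \<Rightarrow> ('o, 'a, 'p, 'b) fnctr \<Rightarrow> ('o, 'a, 'q, 'c) fnctr"
  (infixr "\<odot>" 75) where
  "G \<odot> F = \<lparr>fob = fob G \<circ> fob F, far = far G \<circ> far F\<rparr>"

definition prod_fnctr ::
  "('o, 'a, 'p, 'b) fnctr \<Rightarrow> ('o', 'a', 'p', 'b') fnctr \<Rightarrow>
     ('o \<times> 'o', 'a \<times> 'a', 'p \<times> 'p', 'b \<times> 'b') fnctr" where
  "prod_fnctr F G = \<lparr>fob = map_prod (fob F) (fob G), far = map_prod (far F) (far G)\<rparr>"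

text \<open>\<open>fix_fst C c F\<close> is \<open>F(c,-)\<close> and \<open>fix_snd D d F\<close> is \<open>F(-,d)\<close>, for \<open>F\<close> defined on
  \<open>C \<times> D\<close>.\<close>

definition fix_fst ::
  "('o, 'a) cat \<Rightarrow> 'o \<Rightarrow> ('o \<times> 'p, 'a \<times> 'b, 'q, 'c) fnctr \<Rightarrow> ('p, 'b, 'q, 'c) fnctr" where
  "fix_fst C c F = \<lparr>fob = (\<lambda>d. fob F (c, d)), far = (\<lambda>g. far F (Ident C c, g))\<rparr>"

definition fix_snd ::
  "('p, 'b) cat \<Rightarrow> 'p \<Rightarrow> ('o \<times> 'p, 'a \<times> 'b, 'q, 'c) fnctr \<Rightarrow> ('o, 'a, 'q, 'c) fnctr" where
  "fix_snd D d F = \<lparr>fob = (\<lambda>c. fob F (c, d)), far = (\<lambda>f. far F (f, Ident D d))\<rparr>"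

text \<open>Families of components are required to be \<open>undefined\<close> outside the objects of \<open>C\<close>, so that
  equality in HOL is equality of natural transformations.\<close>

definition nat_trans ::
  "('o, 'a) cat \<Rightarrow> ('p, 'b) cat \<Rightarrow> ('o, 'a, 'p, 'b) fnctr \<Rightarrow> ('o, 'a, 'p, 'b) fnctr \<Rightarrow>
     ('o \<Rightarrow> 'b) set" where
  "nat_trans C D F G =
     {\<tau> \<in> \<Pi>\<^sub>E a\<in>Obj C. Hom D (fob F a) (fob G a).
        \<forall>a\<in>Obj C. \<forall>b\<in>Obj C. \<forall>f\<in>Hom C a b. \<tau> b \<cdot>\<^bsub>D\<^esub> far F f = far G f \<cdot>\<^bsub>D\<^esub> \<tau> a}"


section \<open>Adjunctions and mates\<close>

record ('o, 'a, 'p, 'b) adj =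
  ladj :: "('o, 'a, 'p, 'b) fnctr"
  radj :: "('p, 'b, 'o, 'a) fnctr"
  unit :: "'o \<Rightarrow> 'a"
  counit :: "'p \<Rightarrow> 'b"

locale adjunction =
  L: is_functor A B "ladj J" + R: is_functor B A "radj J"
  for A :: "('o, 'a) cat" and B :: "('p, 'b) cat" and J :: "('o, 'a, 'p, 'b) adj" +
  assumes unit_nat: "unit J \<in> nat_trans A A id_fnctr (radj J \<odot> ladj J)"
    and counit_nat: "counit J \<in> nat_trans B B (ladj J \<odot> radj J) id_fnctr"
    and triangle_left:
      "a \<in> Obj A \<Longrightarrow>
         counit J (fob (ladj J) a) \<cdot>\<^bsub>B\<^esub> far (ladj J) (unit J a) = Ident B (fob (ladj J) a)"
    and triangle_right:
      "b \<in> Obj B \<Longrightarrow>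
         far (radj J) (counit J b) \<cdot>\<^bsub>A\<^esub> unit J (fob (radj J) b) = Ident A (fob (radj J) b)"

definition mates ::
  "('o, 'a) cat \<Rightarrow> ('p, 'b) cat \<Rightarrow> ('o, 'a, 'p, 'b) adj \<Rightarrow>
   ('o', 'a') cat \<Rightarrow> ('p', 'b') cat \<Rightarrow> ('o', 'a', 'p', 'b') adj \<Rightarrow>
   ('o, 'a, 'o', 'a') fnctr \<Rightarrow> ('p, 'b, 'p', 'b') fnctr \<Rightarrow>
   ('o \<Rightarrow> 'b') \<Rightarrow> ('p \<Rightarrow> 'a') \<Rightarrow> bool" where
  "mates A B J A' B' J' H G lam \<rho> \<longleftrightarrow>
     lam \<in> nat_trans A B' (ladj J' \<odot> H) (G \<odot> ladj J) \<and>
     \<rho> \<in> nat_trans B A' (H \<odot> radj J) (radj J' \<odot> G) \<and>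
     (\<forall>b\<in>Obj B. \<rho> b =
        far (radj J') (far G (counit J b)) \<cdot>\<^bsub>A'\<^esub>
        far (radj J') (lam (fob (radj J) b)) \<cdot>\<^bsub>A'\<^esub>
        unit J' (fob H (fob (radj J) b)))"

text \<open>The adjunction with hom-set bijections \<open>\<theta> a b : B(T a, b) \<rightarrow> A(a, S b)\<close>.\<close>

definition adj_of_hom_iso ::
  "('o, 'a) cat \<Rightarrow> ('p, 'b) cat \<Rightarrow> ('o, 'a, 'p, 'b) fnctr \<Rightarrow> ('p, 'b, 'o, 'a) fnctr \<Rightarrow>
     ('o \<Rightarrow> 'p \<Rightarrow> 'b \<Rightarrow> 'a) \<Rightarrow> ('o, 'a, 'p, 'b) adj" where
  "adj_of_hom_iso A B T S \<theta> = \<lparr>ladj = T, radj = S,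
     unit = (\<lambda>a\<in>Obj A. \<theta> a (fob T a) (Ident B (fob T a))),
     counit = (\<lambda>b\<in>Obj B.
       the_inv_into (Hom B (fob T (fob S b)) b) (\<theta> (fob S b) b) (Ident A (fob S b)))\<rparr>"

lemma adjunction_adj_of_hom_iso:
  assumes T: "is_functor A B T" and S: "is_functor B A S"
    and bij: "\<And>a b. \<lbrakk>a \<in> Obj A; b \<in> Obj B\<rbrakk> \<Longrightarrow>
      bij_betw (\<theta> a b) (Hom B (fob T a) b) (Hom A a (fob S b))"
    and nat: "\<And>a a' b b' f u w.
      \<lbrakk>a \<in> Obj A; a' \<in> Obj A; b \<in> Obj B; b' \<in> Obj B;
       u \<in> Hom A a' a; w \<in> Hom B b b'; f \<in> Hom B (fob T a) b\<rbrakk> \<Longrightarrow>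
      \<theta> a' b' (w \<cdot>\<^bsub>B\<^esub> f \<cdot>\<^bsub>B\<^esub> far T u) = far S w \<cdot>\<^bsub>A\<^esub> \<theta> a b f \<cdot>\<^bsub>A\<^esub> u"
  shows "adjunction A B (adj_of_hom_iso A B T S \<theta>)"
proof -
  interpret T: is_functor A B T by fact
  interpret S: is_functor B A S by fact
  let ?J = "adj_of_hom_iso A B T S \<theta>"
  define \<eta> where "\<eta> a = \<theta> a (fob T a) (Ident B (fob T a))" for a
  define \<epsilon> where "\<epsilon> b =
    the_inv_into (Hom B (fob T (fob S b)) b) (\<theta> (fob S b) b) (Ident A (fob S b))" for b
  have \<eta>: "\<eta> a \<in> Hom A a (fob S (fob T a))" if "a \<in> Obj A" for a
    unfolding \<eta>_def using bij[of a "fob T a"] that T.fob_Obj[of a] T.tgt.Ident_Hom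
    by (auto simp: bij_betw_def)
  have \<epsilon>: "\<epsilon> b \<in> Hom B (fob T (fob S b)) b" and \<theta>\<epsilon>: "\<theta> (fob S b) b (\<epsilon> b) = Ident A (fob S b)"
    if "b \<in> Obj B" for b
  proof -
    have b: "bij_betw (\<theta> (fob S b) b) (Hom B (fob T (fob S b)) b) (Hom A (fob S b) (fob S b))"
      using bij that S.fob_Obj by auto
    have "Ident A (fob S b) \<in> Hom A (fob S b) (fob S b)"
      using that S.fob_Obj T.src.Ident_Hom by auto
    then show "\<epsilon> b \<in> Hom B (fob T (fob S b)) b"
      and "\<theta> (fob S b) b (\<epsilon> b) = Ident A (fob S b)"
      using b unfolding \<epsilon>_def
      by (auto simp: bij_betw_def intro: the_inv_into_into f_the_inv_into_f)
  qed
  have \<theta>1: "\<theta> a b f = far S f \<cdot>\<^bsub>A\<^esub> \<eta> a"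
    if a: "a \<in> Obj A" and b: "b \<in> Obj B" and f: "f \<in> Hom B (fob T a) b" for a b f
  proof -
    have Ta: "fob T a \<in> Obj B" using T.fob_Obj a by auto
    note I = T.src.Ident_Hom[OF a] T.tgt.Ident_Hom[OF Ta]
    have "\<theta> a b (f \<cdot>\<^bsub>B\<^esub> Ident B (fob T a) \<cdot>\<^bsub>B\<^esub> far T (Ident A a)) =
          far S f \<cdot>\<^bsub>A\<^esub> \<theta> a (fob T a) (Ident B (fob T a)) \<cdot>\<^bsub>A\<^esub> Ident A a"
      by (rule nat) (use a b Ta f I in auto)
    then show ?thesis
      using f I a T.tgt.Comp_Ident T.src.Comp_Ident \<eta>[OF a]
      by (simp add: T.far_Ident \<eta>_def)
  qed
  have \<theta>2: "\<theta> a b f = far S f \<cdot>\<^bsub>A\<^esub> \<eta> a" "\<theta> a b (\<epsilon> b \<cdot>\<^bsub>B\<^esub> far T g) = g"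
    if a: "a \<in> Obj A" and b: "b \<in> Obj B" and f: "f \<in> Hom B (fob T a) b"
      and g: "g \<in> Hom A a (fob S b)" for a b f g
  proof -
    have Sb: "fob S b \<in> Obj A" using S.fob_Obj b by auto
    have "\<theta> a b (Ident B b \<cdot>\<^bsub>B\<^esub> \<epsilon> b \<cdot>\<^bsub>B\<^esub> far T g) =
          far S (Ident B b) \<cdot>\<^bsub>A\<^esub> \<theta> (fob S b) b (\<epsilon> b) \<cdot>\<^bsub>A\<^esub> g"
      by (rule nat) (use a b Sb g \<epsilon> T.tgt.Ident_Hom in auto)
    moreover have "\<epsilon> b \<cdot>\<^bsub>B\<^esub> far T g \<in> Hom B (fob T a) b"
      using T.tgt.Comp_Hom T.far_Hom g \<epsilon> b by blast
    ultimately show "\<theta> a b (\<epsilon> b \<cdot>\<^bsub>B\<^esub> far T g) = g"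
      using \<theta>\<epsilon>[OF b] b g Sb by (simp add: S.far_Ident T.tgt.Ident_Comp T.src.Ident_Comp)
  qed (use \<theta>1 that in auto)
  have inj: "f = g" if "a \<in> Obj A" "b \<in> Obj B" "f \<in> Hom B (fob T a) b" "g \<in> Hom B (fob T a) b"
    "\<theta> a b f = \<theta> a b g" for a b f g
    using bij[of a b] that by (auto simp: bij_betw_def inj_on_def)
  have \<theta>T: "\<theta> a (fob T a') (far T u) = \<eta> a' \<cdot>\<^bsub>A\<^esub> u"
    if a: "a \<in> Obj A" "a' \<in> Obj A" and u: "u \<in> Hom A a a'" for a a' u
  proof -
    have Ta: "fob T a \<in> Obj B" "fob T a' \<in> Obj B" using T.fob_Obj a by auto
    have "\<theta> a (fob T a') (Ident B (fob T a') \<cdot>\<^bsub>B\<^esub> Ident B (fob T a') \<cdot>\<^bsub>B\<^esub> far T u) =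
          far S (Ident B (fob T a')) \<cdot>\<^bsub>A\<^esub> \<theta> a' (fob T a') (Ident B (fob T a')) \<cdot>\<^bsub>A\<^esub> u"
      by (rule nat) (use a Ta u T.tgt.Ident_Hom in auto)
    moreover have "\<eta> a' \<cdot>\<^bsub>A\<^esub> u \<in> Hom A a (fob S (fob T a'))"
      using T.src.Comp_Hom u \<eta> a by blast
    ultimately show ?thesis
      using Ta T.far_Hom[OF u]
      by (simp add: S.far_Ident \<eta>_def T.tgt.Ident_Comp T.src.Ident_Comp)
  qed
  have un: "\<eta> a' \<cdot>\<^bsub>A\<^esub> u = far S (far T u) \<cdot>\<^bsub>A\<^esub> \<eta> a"
    if a: "a \<in> Obj A" "a' \<in> Obj A" and u: "u \<in> Hom A a a'" for a a' u
    using \<theta>T[OF a u] \<theta>1[OF a(1) T.fob_Obj[OF a(2)] T.far_Hom[OF u]] by simp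
  have cn: "\<epsilon> b' \<cdot>\<^bsub>B\<^esub> far T (far S w) = w \<cdot>\<^bsub>B\<^esub> \<epsilon> b"
    if b: "b \<in> Obj B" "b' \<in> Obj B" and w: "w \<in> Hom B b b'" for b b' w
  proof (rule inj)
    have Sb: "fob S b \<in> Obj A" "fob S b' \<in> Obj A" using S.fob_Obj b by auto
    note Sw = S.far_Hom[OF w]
    show wt: "\<epsilon> b' \<cdot>\<^bsub>B\<^esub> far T (far S w) \<in> Hom B (fob T (fob S b)) b'"
      using T.tgt.Comp_Hom T.far_Hom Sw \<epsilon> b by blast
    show wt': "w \<cdot>\<^bsub>B\<^esub> \<epsilon> b \<in> Hom B (fob T (fob S b)) b'"
      using T.tgt.Comp_Hom w \<epsilon> b by blast
    have "\<theta> (fob S b) b' (w \<cdot>\<^bsub>B\<^esub> \<epsilon> b \<cdot>\<^bsub>B\<^esub> far T (Ident A (fob S b))) =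
          far S w \<cdot>\<^bsub>A\<^esub> \<theta> (fob S b) b (\<epsilon> b) \<cdot>\<^bsub>A\<^esub> Ident A (fob S b)"
      by (rule nat) (use b Sb w \<epsilon> T.src.Ident_Hom in auto)
    then have "\<theta> (fob S b) b' (w \<cdot>\<^bsub>B\<^esub> \<epsilon> b) = far S w"
      using Sb \<theta>\<epsilon>[OF b(1)] T.tgt.Comp_Ident[OF \<epsilon>[OF b(1)]] T.src.Comp_Ident[OF Sw]
        T.src.Comp_Ident[OF T.src.Ident_Hom[OF Sb(1)]]
      by (simp add: T.far_Ident)
    then show "\<theta> (fob S b) b' (\<epsilon> b' \<cdot>\<^bsub>B\<^esub> far T (far S w)) = \<theta> (fob S b) b' (w \<cdot>\<^bsub>B\<^esub> \<epsilon> b)"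
      using \<theta>2(2)[OF Sb(1) b(2) wt Sw] by simp
  qed (use b S.fob_Obj in auto)
  show ?thesis
  proof (unfold_locales, unfold adj_of_hom_iso_def adj.simps)
    show "(\<lambda>a\<in>Obj A. \<theta> a (fob T a) (Ident B (fob T a))) \<in> nat_trans A A id_fnctr (S \<odot> T)"
      unfolding nat_trans_def using \<eta> un
      by (auto simp: id_fnctr_def comp_fnctr_def \<eta>_def[symmetric])
    show "(\<lambda>b\<in>Obj B. the_inv_into (Hom B (fob T (fob S b)) b) (\<theta> (fob S b) b) (Ident A (fob S b)))
        \<in> nat_trans B B (T \<odot> S) id_fnctr"
      unfolding nat_trans_def using \<epsilon> cn
      by (auto simp: id_fnctr_def comp_fnctr_def \<epsilon>_def[symmetric])
    show "(\<lambda>b\<in>Obj B. the_inv_into (Hom B (fob T (fob S b)) b) (\<theta> (fob S b) b) (Ident A (fob S b)))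
          (fob T a) \<cdot>\<^bsub>B\<^esub> far T ((\<lambda>a\<in>Obj A. \<theta> a (fob T a) (Ident B (fob T a))) a) =
        Ident B (fob T a)" if a: "a \<in> Obj A" for a
    proof -
      have Ta: "fob T a \<in> Obj B" using T.fob_Obj a by auto
      note I = T.tgt.Ident_Hom[OF Ta]
      have "\<epsilon> (fob T a) \<cdot>\<^bsub>B\<^esub> far T (\<eta> a) = Ident B (fob T a)"
      proof (rule inj[OF a Ta _ I])
        show "\<epsilon> (fob T a) \<cdot>\<^bsub>B\<^esub> far T (\<eta> a) \<in> Hom B (fob T a) (fob T a)"
          using T.tgt.Comp_Hom T.far_Hom \<eta>[OF a] \<epsilon>[OF Ta] by blast
        show "\<theta> a (fob T a) (\<epsilon> (fob T a) \<cdot>\<^bsub>B\<^esub> far T (\<eta> a)) = \<theta> a (fob T a) (Ident B (fob T a))"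
          using \<theta>2(2)[OF a Ta I \<eta>[OF a]] by (simp add: \<eta>_def)
      qed
      then show ?thesis using a Ta by (simp add: \<eta>_def \<epsilon>_def)
    qed
    show "far S ((\<lambda>b\<in>Obj B. the_inv_into (Hom B (fob T (fob S b)) b) (\<theta> (fob S b) b)
            (Ident A (fob S b))) b) \<cdot>\<^bsub>A\<^esub>
          (\<lambda>a\<in>Obj A. \<theta> a (fob T a) (Ident B (fob T a))) (fob S b) = Ident A (fob S b)"
      if b: "b \<in> Obj B" for b
      using \<theta>1[OF S.fob_Obj[OF b] b \<epsilon>[OF b]] \<theta>\<epsilon>[OF b] b S.fob_Obj[OF b]
      by (simp add: \<eta>_def \<epsilon>_def)
  qed (use T.fob_Obj T.far_Hom T.far_Ident T.far_Comp
         S.fob_Obj S.far_Hom S.far_Ident S.far_Comp in auto)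
qed


section \<open>Two-variable adjunctions\<close>

text \<open>\<open>iso_l k m n\<close> is the bijection \<open>N(k \<otimes> m, n) \<rightarrow> M(m, hom\<^sub>l(k, n))\<close> and \<open>iso_r k m n\<close> is the
  bijection \<open>M(m, hom\<^sub>l(k, n)) \<rightarrow> K(k, hom\<^sub>r(m, n))\<close>.\<close>

record ('ko, 'ka, 'mo, 'ma, 'no, 'na) two_var_adj =
  tensor :: "('ko \<times> 'mo, 'ka \<times> 'ma, 'no, 'na) fnctr"
  hom_l :: "('ko \<times> 'no, 'ka \<times> 'na, 'mo, 'ma) fnctr"
  hom_r :: "('mo \<times> 'no, 'ma \<times> 'na, 'ko, 'ka) fnctr"
  iso_l :: "'ko \<Rightarrow> 'mo \<Rightarrow> 'no \<Rightarrow> 'na \<Rightarrow> 'ma"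
  iso_r :: "'ko \<Rightarrow> 'mo \<Rightarrow> 'no \<Rightarrow> 'ma \<Rightarrow> 'ka"

locale two_variable_adjunction =
  catK: category \<K> + catM: category \<M> + catN: category \<N> +
  tensor: is_functor "prod_cat \<K> \<M>" \<N> "tensor X" +
  hom_l: is_functor "prod_cat (op_cat \<K>) \<N>" \<M> "hom_l X" +
  hom_r: is_functor "prod_cat (op_cat \<M>) \<N>" \<K> "hom_r X"
  for \<K> :: "('ko, 'ka) cat" and \<M> :: "('mo, 'ma) cat" and \<N> :: "('no, 'na) cat"
    and X :: "('ko, 'ka, 'mo, 'ma, 'no, 'na) two_var_adj" +
  assumes iso_l_bij: "\<lbrakk>k \<in> Obj \<K>; m \<in> Obj \<M>; n \<in> Obj \<N>\<rbrakk> \<Longrightarrow>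
      bij_betw (iso_l X k m n)
        (Hom \<N> (fob (tensor X) (k, m)) n) (Hom \<M> m (fob (hom_l X) (k, n)))"
    and iso_r_bij: "\<lbrakk>k \<in> Obj \<K>; m \<in> Obj \<M>; n \<in> Obj \<N>\<rbrakk> \<Longrightarrow>
      bij_betw (iso_r X k m n)
        (Hom \<M> m (fob (hom_l X) (k, n))) (Hom \<K> k (fob (hom_r X) (m, n)))"
    and iso_l_natural:
      "\<lbrakk>k \<in> Obj \<K>; k' \<in> Obj \<K>; m \<in> Obj \<M>; m' \<in> Obj \<M>; n \<in> Obj \<N>; n' \<in> Obj \<N>;
        u \<in> Hom \<K> k' k; v \<in> Hom \<M> m' m; w \<in> Hom \<N> n n';
        f \<in> Hom \<N> (fob (tensor X) (k, m)) n\<rbrakk> \<Longrightarrow>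
       iso_l X k' m' n' (w \<cdot>\<^bsub>\<N>\<^esub> f \<cdot>\<^bsub>\<N>\<^esub> far (tensor X) (u, v)) =
         far (hom_l X) (u, w) \<cdot>\<^bsub>\<M>\<^esub> iso_l X k m n f \<cdot>\<^bsub>\<M>\<^esub> v"
    and iso_r_natural:
      "\<lbrakk>k \<in> Obj \<K>; k' \<in> Obj \<K>; m \<in> Obj \<M>; m' \<in> Obj \<M>; n \<in> Obj \<N>; n' \<in> Obj \<N>;
        u \<in> Hom \<K> k' k; v \<in> Hom \<M> m' m; w \<in> Hom \<N> n n';
        g \<in> Hom \<M> m (fob (hom_l X) (k, n))\<rbrakk> \<Longrightarrow>
       iso_r X k' m' n' (far (hom_l X) (u, w) \<cdot>\<^bsub>\<M>\<^esub> g \<cdot>\<^bsub>\<M>\<^esub> v) =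
         far (hom_r X) (v, w) \<cdot>\<^bsub>\<K>\<^esub> iso_r X k m n g \<cdot>\<^bsub>\<K>\<^esub> u"

text \<open>\<open>k \<otimes> - \<stileturn> hom\<^sub>l(k,-)\<close> between \<open>M\<close> and \<open>N\<close>.\<close>

definition adj_fix_K ::
  "('ko, 'ka) cat \<Rightarrow> ('mo, 'ma) cat \<Rightarrow> ('no, 'na) cat \<Rightarrow>
   ('ko, 'ka, 'mo, 'ma, 'no, 'na) two_var_adj \<Rightarrow> 'ko \<Rightarrow> ('mo, 'ma, 'no, 'na) adj" where
  "adj_fix_K \<K> \<M> \<N> X k =
     adj_of_hom_iso \<M> \<N> (fix_fst \<K> k (tensor X)) (fix_fst (op_cat \<K>) k (hom_l X))
       (\<lambda>m n. iso_l X k m n)"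

text \<open>\<open>- \<otimes> m \<stileturn> hom\<^sub>r(m,-)\<close> between \<open>K\<close> and \<open>N\<close>.\<close>

definition adj_fix_M ::
  "('ko, 'ka) cat \<Rightarrow> ('mo, 'ma) cat \<Rightarrow> ('no, 'na) cat \<Rightarrow>
   ('ko, 'ka, 'mo, 'ma, 'no, 'na) two_var_adj \<Rightarrow> 'mo \<Rightarrow> ('ko, 'ka, 'no, 'na) adj" where
  "adj_fix_M \<K> \<M> \<N> X m =
     adj_of_hom_iso \<K> \<N> (fix_snd \<M> m (tensor X)) (fix_fst (op_cat \<M>) m (hom_r X))
       (\<lambda>k n. iso_r X k m n \<circ> iso_l X k m n)"

text \<open>\<open>hom\<^sub>l(-,n) \<stileturn> hom\<^sub>r(-,n)\<close> between \<open>K\<close> and \<open>M\<^sup>o\<^sup>p\<close>.\<close>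

definition adj_fix_N ::
  "('ko, 'ka) cat \<Rightarrow> ('mo, 'ma) cat \<Rightarrow> ('no, 'na) cat \<Rightarrow>
   ('ko, 'ka, 'mo, 'ma, 'no, 'na) two_var_adj \<Rightarrow> 'no \<Rightarrow> ('ko, 'ka, 'mo, 'ma) adj" where
  "adj_fix_N \<K> \<M> \<N> X n =
     adj_of_hom_iso \<K> (op_cat \<M>) (fix_snd \<N> n (hom_l X)) (fix_snd \<N> n (hom_r X))
       (\<lambda>k m. iso_r X k m n)"

lemma Hom_op_cat [simp]: "Hom (op_cat C) a b = Hom C b a"
  by (auto simp: Hom_def op_cat_def)

lemma op_cat_simps [simp]:
  "Obj (op_cat C) = Obj C" "Ident (op_cat C) = Ident C" "g \<cdot>\<^bsub>op_cat C\<^esub> f = f \<cdot>\<^bsub>C\<^esub> g"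
  by (simp_all add: op_cat_def)

lemma Hom_prod_cat [simp]: "Hom (prod_cat C D) (a, b) (a', b') = Hom C a a' \<times> Hom D b b'"
  by (auto simp: Hom_def prod_cat_def)

lemma prod_cat_simps [simp]:
  "Obj (prod_cat C D) = Obj C \<times> Obj D" "Ident (prod_cat C D) (a, b) = (Ident C a, Ident D b)"
  "(g, g') \<cdot>\<^bsub>prod_cat C D\<^esub> (f, f') = (g \<cdot>\<^bsub>C\<^esub> f, g' \<cdot>\<^bsub>D\<^esub> f')"
  by (simp_all add: prod_cat_def)

lemma (in category) category_op_cat: "category (op_cat C)"
  by unfold_locales
    (auto simp: Dom_Obj Cod_Obj Ident_Hom Comp_Hom Comp_Ident Ident_Comp Comp_assoc,
     auto simp: op_cat_def Dom_Obj Cod_Obj)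

lemma is_functor_fix_fst:
  assumes "category C" "category D" "is_functor (prod_cat C D) E F" "c \<in> Obj C"
  shows "is_functor D E (fix_fst C c F)"
proof -
  interpret C: category C by fact
  interpret D: category D by fact
  interpret F: is_functor "prod_cat C D" E F by fact
  note I = C.Ident_Hom[OF assms(4)]
  show ?thesis
  proof (unfold_locales, unfold fix_fst_def fnctr.simps)
    fix f g a b d assume "f \<in> Hom D a b" "g \<in> Hom D b d"
    then show "far F (Ident C c, g \<cdot>\<^bsub>D\<^esub> f) = far F (Ident C c, g) \<cdot>\<^bsub>E\<^esub> far F (Ident C c, f)"
      using F.far_Comp[of "(Ident C c, f)" "(c, a)" "(c, b)" "(Ident C c, g)" "(c, d)"] I
      by (simp add: C.Comp_Ident)
  qed (use assms(4) I F.fob_Obj F.far_Hom[of "(_, _)" "(_, _)" "(_, _)"]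
         F.far_Ident[of "(_, _)"] in auto)
qed

lemma is_functor_fix_snd:
  assumes "category C" "category D" "is_functor (prod_cat C D) E F" "d \<in> Obj D"
  shows "is_functor C E (fix_snd D d F)"
proof -
  interpret C: category C by fact
  interpret D: category D by fact
  interpret F: is_functor "prod_cat C D" E F by fact
  note I = D.Ident_Hom[OF assms(4)]
  show ?thesis
  proof (unfold_locales, unfold fix_snd_def fnctr.simps)
    fix f g a b c assume "f \<in> Hom C a b" "g \<in> Hom C b c"
    then show "far F (g \<cdot>\<^bsub>C\<^esub> f, Ident D d) = far F (g, Ident D d) \<cdot>\<^bsub>E\<^esub> far F (f, Ident D d)"
      using F.far_Comp[of "(f, Ident D d)" "(a, d)" "(b, d)" "(g, Ident D d)" "(c, d)"] I
      by (simp add: D.Comp_Ident)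
  qed (use assms(4) I F.fob_Obj F.far_Hom[of "(_, _)" "(_, _)" "(_, _)"]
         F.far_Ident[of "(_, _)"] in auto)
qed

lemma is_functor_op:
  assumes "is_functor C D F"
  shows "is_functor (op_cat C) (op_cat D) F"
proof -
  interpret is_functor C D F by fact
  show ?thesis
    by (intro is_functor.intro is_functor_axioms.intro src.category_op_cat tgt.category_op_cat)
      (auto simp: fob_Obj far_Hom far_Ident far_Comp)
qed

lemma op_op_cat [simp]: "op_cat (op_cat C) = C"
  by (cases C) (simp add: op_cat_def)

context two_variable_adjunction
begin

lemma adjunction_adj_fix_K:
  assumes k: "k \<in> Obj \<K>"
  shows "adjunction \<M> \<N> (adj_fix_K \<K> \<M> \<N> X k)"
  unfolding adj_fix_K_def
proof (rule adjunction_adj_of_hom_iso)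
  show "is_functor \<M> \<N> (fix_fst \<K> k (tensor X))"
    by (rule is_functor_fix_fst[OF catK.category_axioms catM.category_axioms
          tensor.is_functor_axioms k])
  show "is_functor \<N> \<M> (fix_fst (op_cat \<K>) k (hom_l X))"
    by (rule is_functor_fix_fst[OF catK.category_op_cat catN.category_axioms
          hom_l.is_functor_axioms]) (use k in simp)
qed (use k iso_l_bij iso_l_natural[OF k k] catK.Ident_Hom[OF k] in
      \<open>auto simp: fix_fst_def\<close>)

lemma adjunction_adj_fix_M:
  assumes m: "m \<in> Obj \<M>"
  shows "adjunction \<K> \<N> (adj_fix_M \<K> \<M> \<N> X m)"
  unfolding adj_fix_M_def
proof (rule adjunction_adj_of_hom_iso)
  show "is_functor \<K> \<N> (fix_snd \<M> m (tensor X))"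
    by (rule is_functor_fix_snd[OF catK.category_axioms catM.category_axioms
          tensor.is_functor_axioms m])
  show "is_functor \<N> \<K> (fix_fst (op_cat \<M>) m (hom_r X))"
    by (rule is_functor_fix_fst[OF catM.category_op_cat catN.category_axioms
          hom_r.is_functor_axioms]) (use m in simp)
  show "bij_betw (iso_r X k m n \<circ> iso_l X k m n)
      (Hom \<N> (fob (fix_snd \<M> m (tensor X)) k) n)
      (Hom \<K> k (fob (fix_fst (op_cat \<M>) m (hom_r X)) n))"
    if "k \<in> Obj \<K>" "n \<in> Obj \<N>" for k n
    using bij_betw_trans[OF iso_l_bij iso_r_bij] that m by (auto simp: fix_fst_def fix_snd_def)
  show "(iso_r X k' m n' \<circ> iso_l X k' m n')
        (w \<cdot>\<^bsub>\<N>\<^esub> f \<cdot>\<^bsub>\<N>\<^esub> far (fix_snd \<M> m (tensor X)) u) =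
      far (fix_fst (op_cat \<M>) m (hom_r X)) w \<cdot>\<^bsub>\<K>\<^esub>
        (iso_r X k m n \<circ> iso_l X k m n) f \<cdot>\<^bsub>\<K>\<^esub> u"
    if k: "k \<in> Obj \<K>" "k' \<in> Obj \<K>" and n: "n \<in> Obj \<N>" "n' \<in> Obj \<N>"
      and u: "u \<in> Hom \<K> k' k" and w: "w \<in> Hom \<N> n n'"
      and f: "f \<in> Hom \<N> (fob (fix_snd \<M> m (tensor X)) k) n" for k k' n n' f u w
  proof -
    note I = catM.Ident_Hom[OF m]
    have f: "f \<in> Hom \<N> (fob (tensor X) (k, m)) n" using f by (simp add: fix_snd_def)
    have "iso_l X k m n f \<in> Hom \<M> m (fob (hom_l X) (k, n))"
      using iso_l_bij[OF k(1) m n(1)] f by (auto simp: bij_betw_def)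
    from iso_r_natural[OF k m m n u I w this] iso_l_natural[OF k m m n u I w f]
    show ?thesis by (simp add: fix_snd_def fix_fst_def)
  qed
qed

lemma adjunction_adj_fix_N:
  assumes n: "n \<in> Obj \<N>"
  shows "adjunction \<K> (op_cat \<M>) (adj_fix_N \<K> \<M> \<N> X n)"
  unfolding adj_fix_N_def
proof (rule adjunction_adj_of_hom_iso)
  have "is_functor (op_cat \<K>) \<M> (fix_snd \<N> n (hom_l X))"
    by (rule is_functor_fix_snd[OF catK.category_op_cat catN.category_axioms
          hom_l.is_functor_axioms n])
  then show "is_functor \<K> (op_cat \<M>) (fix_snd \<N> n (hom_l X))"
    using is_functor_op by fastforce
  show "is_functor (op_cat \<M>) \<K> (fix_snd \<N> n (hom_r X))"
    by (rule is_functor_fix_snd[OF catM.category_op_cat catN.category_axioms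
          hom_r.is_functor_axioms n])
  show "bij_betw (iso_r X k m n) (Hom (op_cat \<M>) (fob (fix_snd \<N> n (hom_l X)) k) m)
      (Hom \<K> k (fob (fix_snd \<N> n (hom_r X)) m))"
    if "k \<in> Obj \<K>" "m \<in> Obj (op_cat \<M>)" for k m
    using iso_r_bij that n by (auto simp: fix_snd_def)
  show "iso_r X k' m' n
        (v \<cdot>\<^bsub>op_cat \<M>\<^esub> f \<cdot>\<^bsub>op_cat \<M>\<^esub> far (fix_snd \<N> n (hom_l X)) u) =
      far (fix_snd \<N> n (hom_r X)) v \<cdot>\<^bsub>\<K>\<^esub> iso_r X k m n f \<cdot>\<^bsub>\<K>\<^esub> u"
    if k: "k \<in> Obj \<K>" "k' \<in> Obj \<K>" and m: "m \<in> Obj (op_cat \<M>)" "m' \<in> Obj (op_cat \<M>)"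
      and u: "u \<in> Hom \<K> k' k" and v: "v \<in> Hom (op_cat \<M>) m m'"
      and f: "f \<in> Hom (op_cat \<M>) (fob (fix_snd \<N> n (hom_l X)) k) m" for k k' m m' f u v
  proof -
    note I = catN.Ident_Hom[OF n]
    have m: "m \<in> Obj \<M>" "m' \<in> Obj \<M>" and v: "v \<in> Hom \<M> m' m"
      and f: "f \<in> Hom \<M> m (fob (hom_l X) (k, n))"
      using m v f by (auto simp: fix_snd_def)
    have "far (hom_l X) (u, Ident \<N> n) \<in> Hom \<M> (fob (hom_l X) (k, n)) (fob (hom_l X) (k', n))"
      by (rule hom_l.far_Hom) (use u I in simp)
    from catM.Comp_assoc[OF v f this] iso_r_natural[OF k m n n u v I f]
    show ?thesis by (simp add: fix_snd_def)
  qed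
qed

end

end

theory Submission
  imports Defs
begin

text \<open>
  The transformations \<open>\<lambda>\<close>, \<open>\<rho>\<^sup>l\<close> and \<open>\<rho>\<^sup>r\<close> are three notations for one thing: a map between
  Set-valued functors on \<open>K\<^sup>o\<^sup>p \<times> M\<^sup>o\<^sup>p \<times> N\<close>.  By the Yoneda lemma, composing with \<open>\<lambda>\<close> turns
  transformations \<open>Kk \<otimes>' Mm \<rightarrow> N(k \<otimes> m)\<close>, natural in \<open>k\<close> and \<open>m\<close>, into exactly the families of maps
  \<open>N(k \<otimes> m, n) \<rightarrow> N'(Kk \<otimes>' Mm, Nn)\<close>, \<open>f \<mapsto> Nf \<cdot> \<lambda>\<close>, that are natural in \<open>k\<close>, \<open>m\<close> and \<open>n\<close>.  In the
  same way \<open>\<rho>\<^sup>l\<close> amounts to a natural family \<open>M(m, hom\<^sub>l(k, n)) \<rightarrow> M'(Mm, hom'\<^sub>l(Kk, Nn))\<close> and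
  \<open>\<rho>\<^sup>r\<close> to a natural family \<open>K(k, hom\<^sub>r(m, n)) \<rightarrow> K'(Kk, hom'\<^sub>r(Mm, Nn))\<close>
  (\<open>Lam_parametrizes\<close>, \<open>Rl_parametrizes\<close>, \<open>Rr_parametrizes\<close>).  The isomorphisms of the two
  adjunctions identify the three sources with each other, and the three targets; conjugating with
  them identifies the three kinds of natural families, hence the three kinds of transformations
  (\<open>transport_bijection\<close>).  Since the families are natural in all three variables from the start,
  joint naturality of the transformations is part of the Yoneda lemma.

  It remains to recognize mates.  Under this bijection \<open>\<lambda>\<close> and \<open>\<rho>\<^sup>l\<close> correspond iff the square made
  of their two families and the isomorphisms \<open>iso_l\<close> commutes; for a fixed \<open>k\<close> this square is
  equivalent to the formula with unit and counit that defines mates (\<open>mates_iff_transpose\<close>).  The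
  other two pairs have squares with \<open>iso_r\<close> and with the composite of \<open>iso_r\<close> and \<open>iso_l\<close>.  The
  square of the composite is obtained by pasting the other two (\<open>square_M_iff_square_N\<close>), which is
  the compatibility of the three bijections.
\<close>

section \<open>Natural transformations as natural families of maps of hom-sets\<close>

lemma fnctr_simps [simp]:
  "fob (G \<odot> F) a = fob G (fob F a)" "far (G \<odot> F) f = far G (far F f)"
  "fob id_fnctr a' = a'" "far id_fnctr f' = f'"
  "fob (prod_fnctr F F') (c, d) = (fob F c, fob F' d)"
  "far (prod_fnctr F F') (u, v) = (far F u, far F' v)"
  "fob (fix_fst C c P) d = fob P (c, d)" "far (fix_fst C c P) v = far P (Ident C c, v)"
  "fob (fix_snd D d P) c = fob P (c, d)" "far (fix_snd D d P) u = far P (u, Ident D d)"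
  by (simp_all add: comp_fnctr_def id_fnctr_def prod_fnctr_def fix_fst_def fix_snd_def)

lemma is_functor_comp:
  assumes "is_functor C D F" "is_functor D E G"
  shows "is_functor C E (G \<odot> F)"
proof -
  interpret F: is_functor C D F by fact
  interpret G: is_functor D E G by fact
  show ?thesis
    by unfold_locales
      (auto simp: F.fob_Obj G.fob_Obj F.far_Ident G.far_Ident
        intro: F.far_Hom G.far_Hom F.far_Comp[THEN arg_cong[where f = "far G"], THEN trans]
          G.far_Comp)
qed

lemma (in category) category_prod_cat:
  assumes "category D"
  shows "category (prod_cat C D)"
proof -
  interpret D: category D by fact
  show ?thesis
    by unfold_locales
      (auto simp: Comp_Ident D.Comp_Ident Ident_Comp D.Ident_Comp Comp_assoc D.Comp_assoc
        Ident_Hom D.Ident_Hom intro: Comp_Hom D.Comp_Hom,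
       auto simp: prod_cat_def Dom_Obj Cod_Obj D.Dom_Obj D.Cod_Obj)
qed

lemma is_functor_prod:
  assumes "is_functor C C' F" "is_functor D D' G"
  shows "is_functor (prod_cat C D) (prod_cat C' D') (prod_fnctr F G)"
proof -
  interpret F: is_functor C C' F by fact
  interpret G: is_functor D D' G by fact
  show ?thesis
    by (intro is_functor.intro is_functor_axioms.intro F.src.category_prod_cat
        F.tgt.category_prod_cat G.src.category_axioms G.tgt.category_axioms)
      (auto simp: F.fob_Obj G.fob_Obj F.far_Ident G.far_Ident
        F.far_Hom G.far_Hom F.far_Comp G.far_Comp)
qed

lemma nat_trans_Hom:
  "\<lbrakk>\<tau> \<in> nat_trans C D F G; a \<in> Obj C\<rbrakk> \<Longrightarrow> \<tau> a \<in> Hom D (fob F a) (fob G a)"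
  by (auto simp: nat_trans_def)

lemma nat_trans_natural:
  "\<lbrakk>\<tau> \<in> nat_trans C D F G; a \<in> Obj C; b \<in> Obj C; f \<in> Hom C a b\<rbrakk>
    \<Longrightarrow> \<tau> b \<cdot>\<^bsub>D\<^esub> far F f = far G f \<cdot>\<^bsub>D\<^esub> \<tau> a"
  by (auto simp: nat_trans_def)

lemma nat_trans_eqI:
  assumes "\<sigma> \<in> nat_trans C D F G" "\<tau> \<in> nat_trans C D F G" "\<And>a. a \<in> Obj C \<Longrightarrow> \<sigma> a = \<tau> a"
  shows "\<sigma> = \<tau>"
  using assms unfolding nat_trans_def by (auto intro: PiE_ext)

lemma nat_trans_op: "nat_trans (op_cat C) (op_cat D) F G = nat_trans C D G F"
  unfolding nat_trans_def by fastforce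

lemma nat_trans_fix_fst:
  assumes "category C" "\<tau> \<in> nat_trans (prod_cat C D) E F G" "c \<in> Obj C"
  shows "(\<lambda>d\<in>Obj D. \<tau> (c, d)) \<in> nat_trans D E (fix_fst C c F) (fix_fst C c G)"
  using nat_trans_Hom[OF assms(2)]
    nat_trans_natural[OF assms(2), of "(c, _)" "(c, _)" "(Ident C c, _)"]
    category.Ident_Hom[OF assms(1,3)] assms(3)
  by (auto simp: nat_trans_def[of D])

lemma nat_trans_fix_snd:
  assumes "category D" "\<tau> \<in> nat_trans (prod_cat C D) E F G" "d \<in> Obj D"
  shows "(\<lambda>c\<in>Obj C. \<tau> (c, d)) \<in> nat_trans C E (fix_snd D d F) (fix_snd D d G)"
  using nat_trans_Hom[OF assms(2)]
    nat_trans_natural[OF assms(2), of "(_, d)" "(_, d)" "(_, Ident D d)"]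
    category.Ident_Hom[OF assms(1,3)] assms(3)
  by (auto simp: nat_trans_def[of C])

text \<open>These are the natural transformations \<open>B(T-, -) \<rightarrow> B'(T'-, G-)\<close> of functors
  \<open>C\<^sup>o\<^sup>p \<times> B \<rightarrow> Set\<close>; naturality in both variables is expressed by a single equation.\<close>

definition hom_family ::
  "('o, 'a) cat \<Rightarrow> ('p, 'b) cat \<Rightarrow> ('q, 'c) cat \<Rightarrow> ('o, 'a, 'p, 'b) fnctr \<Rightarrow>
   ('o, 'a, 'q, 'c) fnctr \<Rightarrow> ('p, 'b, 'q, 'c) fnctr \<Rightarrow> ('o \<Rightarrow> 'p \<Rightarrow> 'b \<Rightarrow> 'c) \<Rightarrow> bool" where
  "hom_family C B B' T T' G \<phi> \<longleftrightarrow>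
     (\<forall>c\<in>Obj C. \<forall>b\<in>Obj B. \<forall>f\<in>Hom B (fob T c) b. \<phi> c b f \<in> Hom B' (fob T' c) (fob G b)) \<and>
     (\<forall>c\<in>Obj C. \<forall>c'\<in>Obj C. \<forall>b\<in>Obj B. \<forall>b'\<in>Obj B.
        \<forall>u\<in>Hom C c' c. \<forall>w\<in>Hom B b b'. \<forall>f\<in>Hom B (fob T c) b.
        \<phi> c' b' (w \<cdot>\<^bsub>B\<^esub> f \<cdot>\<^bsub>B\<^esub> far T u) = far G w \<cdot>\<^bsub>B'\<^esub> \<phi> c b f \<cdot>\<^bsub>B'\<^esub> far T' u)"

locale hom_family_setting =
  T: is_functor C B T + T': is_functor C B' T' + G: is_functor B B' G
  for C :: "('o, 'a) cat" and B :: "('p, 'b) cat" and B' :: "('q, 'c) cat" and T T' G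
begin

lemma nat_trans_hom_family:
  assumes lam: "lam \<in> nat_trans C B' T' (G \<odot> T)"
  shows "hom_family C B B' T T' G (\<lambda>c b f. far G f \<cdot>\<^bsub>B'\<^esub> lam c)"
  unfolding hom_family_def
proof (intro conjI ballI)
  fix c b f assume "c \<in> Obj C" "b \<in> Obj B" "f \<in> Hom B (fob T c) b"
  then show "far G f \<cdot>\<^bsub>B'\<^esub> lam c \<in> Hom B' (fob T' c) (fob G b)"
    using nat_trans_Hom[OF lam, of c] by (auto intro!: T'.tgt.Comp_Hom G.far_Hom)
next
  fix c c' b b' u w f
  assume c: "c \<in> Obj C" "c' \<in> Obj C" and u: "u \<in> Hom C c' c" and w: "w \<in> Hom B b b'"
    and f: "f \<in> Hom B (fob T c) b"
  note Tu = T.far_Hom[OF u] and T'u = T'.far_Hom[OF u]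
  note fTu = T.tgt.Comp_Hom[OF Tu f]
  have l: "lam c \<in> Hom B' (fob T' c) (fob G (fob T c))"
    and l': "lam c' \<in> Hom B' (fob T' c') (fob G (fob T c'))"
    using nat_trans_Hom[OF lam] c by auto
  have nat: "lam c \<cdot>\<^bsub>B'\<^esub> far T' u = far G (far T u) \<cdot>\<^bsub>B'\<^esub> lam c'"
    using nat_trans_natural[OF lam c(2,1) u] by simp
  have "far G (w \<cdot>\<^bsub>B\<^esub> f \<cdot>\<^bsub>B\<^esub> far T u) \<cdot>\<^bsub>B'\<^esub> lam c' =
      (far G w \<cdot>\<^bsub>B'\<^esub> (far G f \<cdot>\<^bsub>B'\<^esub> far G (far T u))) \<cdot>\<^bsub>B'\<^esub> lam c'"
    by (simp add: G.far_Comp[OF fTu w] G.far_Comp[OF Tu f])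
  also have "\<dots> = far G w \<cdot>\<^bsub>B'\<^esub> (far G f \<cdot>\<^bsub>B'\<^esub> (far G (far T u) \<cdot>\<^bsub>B'\<^esub> lam c'))"
    using T'.tgt.Comp_assoc[OF l' G.far_Hom[OF Tu] G.far_Hom[OF f]]
      T'.tgt.Comp_assoc[OF l' T'.tgt.Comp_Hom[OF G.far_Hom[OF Tu] G.far_Hom[OF f]]
        G.far_Hom[OF w]] by simp
  also have "\<dots> = far G w \<cdot>\<^bsub>B'\<^esub> (far G f \<cdot>\<^bsub>B'\<^esub> lam c) \<cdot>\<^bsub>B'\<^esub> far T' u"
    using T'.tgt.Comp_assoc[OF T'u l G.far_Hom[OF f]] nat by simp
  finally show "far G (w \<cdot>\<^bsub>B\<^esub> f \<cdot>\<^bsub>B\<^esub> far T u) \<cdot>\<^bsub>B'\<^esub> lam c' =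
      far G w \<cdot>\<^bsub>B'\<^esub> (far G f \<cdot>\<^bsub>B'\<^esub> lam c) \<cdot>\<^bsub>B'\<^esub> far T' u" .
qed

text \<open>The Yoneda argument: \<open>\<lambda>\<close> consists of the values of \<open>\<phi>\<close> at identities.  Naturality of \<open>\<phi>\<close> in the
  second variable then forces the formula for \<open>\<phi>\<close>, and naturality in the first variable makes
  \<open>\<lambda>\<close> natural.\<close>

lemma hom_family_representable:
  assumes \<phi>: "hom_family C B B' T T' G \<phi>"
  obtains lam where "lam \<in> nat_trans C B' T' (G \<odot> T)"
    and "\<And>c b f. \<lbrakk>c \<in> Obj C; b \<in> Obj B; f \<in> Hom B (fob T c) b\<rbrakk>
      \<Longrightarrow> \<phi> c b f = far G f \<cdot>\<^bsub>B'\<^esub> lam c"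
proof
  define lam where "lam = (\<lambda>c\<in>Obj C. \<phi> c (fob T c) (Ident B (fob T c)))"
  have typed: "\<phi> c b f \<in> Hom B' (fob T' c) (fob G b)"
    if "c \<in> Obj C" "b \<in> Obj B" "f \<in> Hom B (fob T c) b" for c b f
    using \<phi> that unfolding hom_family_def by blast
  have nat: "\<phi> c' b' (w \<cdot>\<^bsub>B\<^esub> f \<cdot>\<^bsub>B\<^esub> far T u) = far G w \<cdot>\<^bsub>B'\<^esub> \<phi> c b f \<cdot>\<^bsub>B'\<^esub> far T' u"
    if "c \<in> Obj C" "c' \<in> Obj C" "b \<in> Obj B" "b' \<in> Obj B" "u \<in> Hom C c' c" "w \<in> Hom B b b'"
      "f \<in> Hom B (fob T c) b" for c c' b b' u w f
    using \<phi> that unfolding hom_family_def by blast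
  have lam: "lam c \<in> Hom B' (fob T' c) (fob G (fob T c))" if "c \<in> Obj C" for c
    using typed[OF that] T.fob_Obj[OF that] T.tgt.Ident_Hom that by (simp add: lam_def)
  show repr: "\<phi> c b f = far G f \<cdot>\<^bsub>B'\<^esub> lam c"
    if c: "c \<in> Obj C" and b: "b \<in> Obj B" and f: "f \<in> Hom B (fob T c) b" for c b f
    using nat[OF c c T.fob_Obj[OF c] b T.src.Ident_Hom[OF c] f T.tgt.Ident_Hom]
      T.tgt.Comp_Ident[OF T.tgt.Ident_Hom[OF T.fob_Obj[OF c]]] T.tgt.Comp_Ident[OF f]
      T'.tgt.Comp_Ident[OF lam[OF c]] c T.fob_Obj[OF c]
    by (simp add: T.far_Ident T'.far_Ident lam_def)
  show "lam \<in> nat_trans C B' T' (G \<odot> T)"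
    unfolding nat_trans_def
  proof (intro CollectI conjI ballI)
    show "lam \<in> (\<Pi>\<^sub>E a\<in>Obj C. Hom B' (fob T' a) (fob (G \<odot> T) a))"
      using lam by (auto simp: lam_def)
  next
    fix c' c u assume c: "c' \<in> Obj C" "c \<in> Obj C" and u: "u \<in> Hom C c' c"
    note Tc = T.fob_Obj[OF c(2)]
    have "\<phi> c' (fob T c) (far T u) = lam c \<cdot>\<^bsub>B'\<^esub> far T' u"
      using nat[OF c(2,1) Tc Tc u T.tgt.Ident_Hom[OF Tc] T.tgt.Ident_Hom[OF Tc]]
        T'.tgt.Comp_Hom[OF T'.far_Hom[OF u] lam[OF c(2)]] c(2) Tc T.far_Hom[OF u]
      by (simp add: G.far_Ident T.tgt.Ident_Comp T'.tgt.Ident_Comp lam_def)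
    then show "lam c \<cdot>\<^bsub>B'\<^esub> far T' u = far (G \<odot> T) u \<cdot>\<^bsub>B'\<^esub> lam c'"
      using repr[OF c(1) Tc T.far_Hom[OF u]] by simp
  qed
qed

lemma hom_family_unique_representation:
  assumes "hom_family C B B' T T' G \<phi>"
  shows "\<exists>!lam. lam \<in> nat_trans C B' T' (G \<odot> T) \<and>
    (\<forall>c\<in>Obj C. \<forall>b\<in>Obj B. \<forall>f\<in>Hom B (fob T c) b. \<phi> c b f = far G f \<cdot>\<^bsub>B'\<^esub> lam c)"
proof -
  obtain lam where lam: "lam \<in> nat_trans C B' T' (G \<odot> T)"
      "\<And>c b f. \<lbrakk>c \<in> Obj C; b \<in> Obj B; f \<in> Hom B (fob T c) b\<rbrakk>
        \<Longrightarrow> \<phi> c b f = far G f \<cdot>\<^bsub>B'\<^esub> lam c"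
    using hom_family_representable[OF assms] by blast
  show ?thesis
  proof (intro ex1I conjI ballI)
    fix mu
    assume mu: "mu \<in> nat_trans C B' T' (G \<odot> T) \<and>
      (\<forall>c\<in>Obj C. \<forall>b\<in>Obj B. \<forall>f\<in>Hom B (fob T c) b. \<phi> c b f = far G f \<cdot>\<^bsub>B'\<^esub> mu c)"
    show "mu = lam"
    proof (rule nat_trans_eqI[OF conjunct1[OF mu] lam(1)])
      fix c assume c: "c \<in> Obj C"
      note Tc = T.fob_Obj[OF c]
      note id = T.tgt.Ident_Hom[OF Tc]
      have "far G (Ident B (fob T c)) \<cdot>\<^bsub>B'\<^esub> mu c = far G (Ident B (fob T c)) \<cdot>\<^bsub>B'\<^esub> lam c"
        using mu lam(2)[OF c Tc id] c Tc id by metis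
      then show "mu c = lam c"
        using nat_trans_Hom[OF lam(1) c] nat_trans_Hom[OF conjunct1[OF mu] c]
        by (simp add: G.far_Ident[OF Tc] T'.tgt.Ident_Comp)
    qed
  qed (use lam in auto)
qed

end

section \<open>Mates in terms of transposition\<close>

text \<open>A map \<open>f : Ta \<rightarrow> b\<close> has the transpose \<open>Sf \<cdot> \<eta>\<close>, so the right-hand side says that transposition
  takes the map \<open>f \<mapsto> Gf \<cdot> \<lambda>\<close> of hom-sets to \<open>g \<mapsto> \<rho> \<cdot> Hg\<close>.  The transpose of a counit is an identity;
  hence the case \<open>f = \<epsilon>\<close> is the formula defining mates.  Conversely, that formula yields the
  case of an identity \<open>f\<close>, by a triangle identity, and naturality of \<open>\<rho>\<close> extends it to every \<open>f\<close>.\<close>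

lemma mates_iff_transpose:
  assumes J: "adjunction A B J" and J': "adjunction A' B' J'"
    and H: "is_functor A A' H" and G: "is_functor B B' G"
    and lam: "lam \<in> nat_trans A B' (ladj J' \<odot> H) (G \<odot> ladj J)"
    and \<rho>: "\<rho> \<in> nat_trans B A' (H \<odot> radj J) (radj J' \<odot> G)"
  shows "mates A B J A' B' J' H G lam \<rho> \<longleftrightarrow>
    (\<forall>a\<in>Obj A. \<forall>b\<in>Obj B. \<forall>f\<in>Hom B (fob (ladj J) a) b.
       far (radj J') (far G f \<cdot>\<^bsub>B'\<^esub> lam a) \<cdot>\<^bsub>A'\<^esub> unit J' (fob H a) =
       \<rho> b \<cdot>\<^bsub>A'\<^esub> far H (far (radj J) f \<cdot>\<^bsub>A\<^esub> unit J a))" (is "_ \<longleftrightarrow> ?squares")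
proof -
  interpret H: is_functor A A' H by fact
  interpret G: is_functor B B' G by fact
  interpret J: adjunction A B J by fact
  interpret J': adjunction A' B' J' by fact
  let ?T = "ladj J" and ?S = "radj J" and ?T' = "ladj J'" and ?S' = "radj J'"
  note assoc = H.tgt.Comp_assoc
  have unit: "unit J a \<in> Hom A a (fob ?S (fob ?T a))" if "a \<in> Obj A" for a
    using nat_trans_Hom[OF J.unit_nat that] by simp
  have counit: "counit J b \<in> Hom B (fob ?T (fob ?S b)) b" if "b \<in> Obj B" for b
    using nat_trans_Hom[OF J.counit_nat that] by simp
  have unit': "unit J' a \<in> Hom A' a (fob ?S' (fob ?T' a))" if "a \<in> Obj A'" for a
    using nat_trans_Hom[OF J'.unit_nat that] by simp
  have lamH: "lam a \<in> Hom B' (fob ?T' (fob H a)) (fob G (fob ?T a))" if "a \<in> Obj A" for a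
    using nat_trans_Hom[OF lam that] by simp
  have \<rho>H: "\<rho> b \<in> Hom A' (fob H (fob ?S b)) (fob ?S' (fob G b))" if "b \<in> Obj B" for b
    using nat_trans_Hom[OF \<rho> that] by simp
  have mate: "far ?S' (far G (counit J b)) \<cdot>\<^bsub>A'\<^esub> far ?S' (lam (fob ?S b)) \<cdot>\<^bsub>A'\<^esub>
        unit J' (fob H (fob ?S b)) =
      far ?S' (far G (counit J b) \<cdot>\<^bsub>B'\<^esub> lam (fob ?S b)) \<cdot>\<^bsub>A'\<^esub> unit J' (fob H (fob ?S b))"
    if b: "b \<in> Obj B" for b
  proof -
    note Sb = J.R.fob_Obj[OF b]
    note G\<epsilon> = G.far_Hom[OF counit[OF b]]
    show ?thesis
      using assoc[OF unit'[OF H.fob_Obj[OF Sb]] J'.R.far_Hom[OF lamH[OF Sb]] J'.R.far_Hom[OF G\<epsilon>]]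
        J'.R.far_Comp[OF lamH[OF Sb] G\<epsilon>] by simp
  qed
  have mates: "mates A B J A' B' J' H G lam \<rho> \<longleftrightarrow> (\<forall>b\<in>Obj B. \<rho> b =
      far ?S' (far G (counit J b) \<cdot>\<^bsub>B'\<^esub> lam (fob ?S b)) \<cdot>\<^bsub>A'\<^esub> unit J' (fob H (fob ?S b)))"
    unfolding mates_def using lam \<rho> by (simp add: mate cong: ball_cong)
  have "?squares" if \<rho>_eq: "\<And>b. b \<in> Obj B \<Longrightarrow> \<rho> b =
      far ?S' (far G (counit J b) \<cdot>\<^bsub>B'\<^esub> lam (fob ?S b)) \<cdot>\<^bsub>A'\<^esub> unit J' (fob H (fob ?S b))"
  proof (intro ballI)
    fix a b f assume a: "a \<in> Obj A" and b: "b \<in> Obj B" and f: "f \<in> Hom B (fob ?T a) b"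
    note Ta = J.L.fob_Obj[OF a]
    note STa = J.R.fob_Obj[OF Ta]
    note Ha = H.fob_Obj[OF a] and HSTa = H.fob_Obj[OF STa]
    note H\<eta> = H.far_Hom[OF unit[OF a]]
    note T'H\<eta> = J'.L.far_Hom[OF H\<eta>]
    note G\<epsilon> = G.far_Hom[OF counit[OF Ta]]
    note Gf = G.far_Hom[OF f]
    note lamSTa = lamH[OF STa] and lama = lamH[OF a]
    note GT\<eta> = G.far_Hom[OF J.L.far_Hom[OF unit[OF a]]]
    note G\<epsilon>lam = G.tgt.Comp_Hom[OF lamSTa G\<epsilon>]
    \<comment> \<open>The square at the identity of \<open>Ta\<close>.\<close>
    have "\<rho> (fob ?T a) \<cdot>\<^bsub>A'\<^esub> far H (unit J a) =
        far ?S' (far G (counit J (fob ?T a)) \<cdot>\<^bsub>B'\<^esub> lam (fob ?S (fob ?T a))) \<cdot>\<^bsub>A'\<^esub>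
          unit J' (fob H (fob ?S (fob ?T a))) \<cdot>\<^bsub>A'\<^esub> far H (unit J a)"
      using assoc[OF H\<eta> unit'[OF HSTa] J'.R.far_Hom[OF G\<epsilon>lam]] \<rho>_eq[OF Ta] by simp
    also have "unit J' (fob H (fob ?S (fob ?T a))) \<cdot>\<^bsub>A'\<^esub> far H (unit J a) =
        far ?S' (far ?T' (far H (unit J a))) \<cdot>\<^bsub>A'\<^esub> unit J' (fob H a)"
      using nat_trans_natural[OF J'.unit_nat Ha HSTa H\<eta>] by simp
    also have "far ?S' (far G (counit J (fob ?T a)) \<cdot>\<^bsub>B'\<^esub> lam (fob ?S (fob ?T a))) \<cdot>\<^bsub>A'\<^esub> \<dots> =
        far ?S' ((far G (counit J (fob ?T a)) \<cdot>\<^bsub>B'\<^esub> lam (fob ?S (fob ?T a))) \<cdot>\<^bsub>B'\<^esub>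
          far ?T' (far H (unit J a))) \<cdot>\<^bsub>A'\<^esub> unit J' (fob H a)"
      using assoc[OF unit'[OF Ha] J'.R.far_Hom[OF T'H\<eta>] J'.R.far_Hom[OF G\<epsilon>lam]]
        J'.R.far_Comp[OF T'H\<eta> G\<epsilon>lam] by simp
    also have "(far G (counit J (fob ?T a)) \<cdot>\<^bsub>B'\<^esub> lam (fob ?S (fob ?T a))) \<cdot>\<^bsub>B'\<^esub>
          far ?T' (far H (unit J a)) =
        far G (counit J (fob ?T a)) \<cdot>\<^bsub>B'\<^esub> far G (far ?T (unit J a)) \<cdot>\<^bsub>B'\<^esub> lam a"
      using G.tgt.Comp_assoc[OF T'H\<eta> lamSTa G\<epsilon>] nat_trans_natural[OF lam a STa unit[OF a]]
      by simp
    also have "\<dots> = far G (counit J (fob ?T a) \<cdot>\<^bsub>B\<^esub> far ?T (unit J a)) \<cdot>\<^bsub>B'\<^esub> lam a"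
      using G.tgt.Comp_assoc[OF lama GT\<eta> G\<epsilon>]
        G.far_Comp[OF J.L.far_Hom[OF unit[OF a]] counit[OF Ta]] by simp
    also have "\<dots> = lam a"
      using J.triangle_left[OF a] G.far_Ident[OF Ta] G.tgt.Ident_Comp[OF lama] by simp
    finally have unit_square: "\<rho> (fob ?T a) \<cdot>\<^bsub>A'\<^esub> far H (unit J a) =
      far ?S' (lam a) \<cdot>\<^bsub>A'\<^esub> unit J' (fob H a)" .
    have "\<rho> b \<cdot>\<^bsub>A'\<^esub> far H (far ?S f \<cdot>\<^bsub>A\<^esub> unit J a) =
        (\<rho> b \<cdot>\<^bsub>A'\<^esub> far H (far ?S f)) \<cdot>\<^bsub>A'\<^esub> far H (unit J a)"
      using assoc[OF H\<eta> H.far_Hom[OF J.R.far_Hom[OF f]] \<rho>H[OF b]]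
        H.far_Comp[OF unit[OF a] J.R.far_Hom[OF f]] by simp
    also have "\<dots> = (far ?S' (far G f) \<cdot>\<^bsub>A'\<^esub> \<rho> (fob ?T a)) \<cdot>\<^bsub>A'\<^esub> far H (unit J a)"
      using nat_trans_natural[OF \<rho> Ta b f] by simp
    also have "\<dots> = far ?S' (far G f) \<cdot>\<^bsub>A'\<^esub> far ?S' (lam a) \<cdot>\<^bsub>A'\<^esub> unit J' (fob H a)"
      using assoc[OF H\<eta> \<rho>H[OF Ta] J'.R.far_Hom[OF Gf]] unit_square by simp
    also have "\<dots> = far ?S' (far G f \<cdot>\<^bsub>B'\<^esub> lam a) \<cdot>\<^bsub>A'\<^esub> unit J' (fob H a)"
      using assoc[OF unit'[OF Ha] J'.R.far_Hom[OF lama] J'.R.far_Hom[OF Gf]]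
        J'.R.far_Comp[OF lama Gf] by simp
    finally show "far ?S' (far G f \<cdot>\<^bsub>B'\<^esub> lam a) \<cdot>\<^bsub>A'\<^esub> unit J' (fob H a) =
      \<rho> b \<cdot>\<^bsub>A'\<^esub> far H (far ?S f \<cdot>\<^bsub>A\<^esub> unit J a)" ..
  qed
  moreover have "\<rho> b =
      far ?S' (far G (counit J b) \<cdot>\<^bsub>B'\<^esub> lam (fob ?S b)) \<cdot>\<^bsub>A'\<^esub> unit J' (fob H (fob ?S b))"
    if squares: ?squares and b: "b \<in> Obj B" for b
    using squares[rule_format, OF J.R.fob_Obj[OF b] b counit[OF b]] J.triangle_right[OF b]
      H.far_Ident[OF J.R.fob_Obj[OF b]] H.tgt.Comp_Ident[OF \<rho>H[OF b]] by simp
  ultimately show ?thesis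
    unfolding mates by blast
qed

context two_variable_adjunction
begin

lemma iso_l_Hom:
  "\<lbrakk>k \<in> Obj \<K>; m \<in> Obj \<M>; n \<in> Obj \<N>; f \<in> Hom \<N> (fob (tensor X) (k, m)) n\<rbrakk>
    \<Longrightarrow> iso_l X k m n f \<in> Hom \<M> m (fob (hom_l X) (k, n))"
  by (rule bij_betw_apply[OF iso_l_bij])

lemma iso_r_Hom:
  "\<lbrakk>k \<in> Obj \<K>; m \<in> Obj \<M>; n \<in> Obj \<N>; g \<in> Hom \<M> m (fob (hom_l X) (k, n))\<rbrakk>
    \<Longrightarrow> iso_r X k m n g \<in> Hom \<K> k (fob (hom_r X) (m, n))"
  by (rule bij_betw_apply[OF iso_r_bij])

text \<open>The unit is the image of an identity under the hom-set bijection; by naturality of the bijection,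
  transposition with this unit is therefore the bijection itself.  The same holds for each of the
  three adjunctions obtained by fixing a variable.\<close>

lemma transpose_adj_fix_K:
  assumes k: "k \<in> Obj \<K>" and m: "m \<in> Obj \<M>" and n: "n \<in> Obj \<N>"
    and f: "f \<in> Hom \<N> (fob (tensor X) (k, m)) n"
  shows "far (radj (adj_fix_K \<K> \<M> \<N> X k)) f \<cdot>\<^bsub>\<M>\<^esub> unit (adj_fix_K \<K> \<M> \<N> X k) m = iso_l X k m n f"
proof -
  have t: "fob (tensor X) (k, m) \<in> Obj \<N>" using tensor.fob_Obj k m by simp
  note I = catK.Ident_Hom[OF k] catM.Ident_Hom[OF m] catN.Ident_Hom[OF t]
  show ?thesis
    using iso_l_natural[OF k k m m t n I(1,2) f I(3)] m k f
      catM.Comp_Ident[OF iso_l_Hom[OF k m t I(3)]] tensor.far_Ident[of "(k, m)"]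
    by (simp add: adj_fix_K_def adj_of_hom_iso_def catN.Comp_Ident[OF I(3)] catN.Comp_Ident[OF f])
qed

lemma transpose_adj_fix_M:
  assumes k: "k \<in> Obj \<K>" and m: "m \<in> Obj \<M>" and n: "n \<in> Obj \<N>"
    and f: "f \<in> Hom \<N> (fob (tensor X) (k, m)) n"
  shows "far (radj (adj_fix_M \<K> \<M> \<N> X m)) f \<cdot>\<^bsub>\<K>\<^esub> unit (adj_fix_M \<K> \<M> \<N> X m) k =
    iso_r X k m n (iso_l X k m n f)"
proof -
  have t: "fob (tensor X) (k, m) \<in> Obj \<N>" using tensor.fob_Obj k m by simp
  note I = catK.Ident_Hom[OF k] catM.Ident_Hom[OF m] catN.Ident_Hom[OF t]
  note g = iso_l_Hom[OF k m t I(3)]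
  show ?thesis
    using iso_l_natural[OF k k m m t n I(1,2) f I(3)] iso_r_natural[OF k k m m t n I(1,2) f g]
      m k f catK.Comp_Ident[OF iso_r_Hom[OF k m t g]] tensor.far_Ident[of "(k, m)"]
    by (simp add: adj_fix_M_def adj_of_hom_iso_def catN.Comp_Ident[OF I(3)] catN.Comp_Ident[OF f])
qed

lemma transpose_adj_fix_N:
  assumes k: "k \<in> Obj \<K>" and m: "m \<in> Obj \<M>" and n: "n \<in> Obj \<N>"
    and g: "g \<in> Hom \<M> m (fob (hom_l X) (k, n))"
  shows "far (radj (adj_fix_N \<K> \<M> \<N> X n)) g \<cdot>\<^bsub>\<K>\<^esub> unit (adj_fix_N \<K> \<M> \<N> X n) k = iso_r X k m n g"
proof -
  have h: "fob (hom_l X) (k, n) \<in> Obj \<M>" using hom_l.fob_Obj k n by simp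
  note I = catK.Ident_Hom[OF k] catN.Ident_Hom[OF n] catM.Ident_Hom[OF h]
  show ?thesis
    using iso_r_natural[OF k k h m n n I(1) g I(2) I(3)] k n
      catK.Comp_Ident[OF iso_r_Hom[OF k h n I(3)]] hom_l.far_Ident[of "(k, n)"]
    by (simp add: adj_fix_N_def adj_of_hom_iso_def catM.Ident_Comp[OF g])
qed

end

section \<open>Equivariant maps between Set-valued functors\<close>

text \<open>\<open>I\<close> and \<open>J\<close> are the objects and hom-sets of an index category, and \<open>P\<close> with the action \<open>p\<close>, or
  \<open>Q\<close> with the action \<open>q\<close>, is a Set-valued functor on it; \<open>\<theta>\<close> is a natural transformation.\<close>

definition equivariant ::
  "'i set \<Rightarrow> ('i \<Rightarrow> 'i \<Rightarrow> 'j set) \<Rightarrow> ('i \<Rightarrow> 'x set) \<Rightarrow> ('j \<Rightarrow> 'x \<Rightarrow> 'x) \<Rightarrow>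
   ('i \<Rightarrow> 'y set) \<Rightarrow> ('j \<Rightarrow> 'y \<Rightarrow> 'y) \<Rightarrow> ('i \<Rightarrow> 'x \<Rightarrow> 'y) \<Rightarrow> bool" where
  "equivariant I J P p Q q \<theta> \<longleftrightarrow>
     (\<forall>i\<in>I. \<forall>x\<in>P i. \<theta> i x \<in> Q i) \<and>
     (\<forall>i\<in>I. \<forall>i'\<in>I. \<forall>j\<in>J i i'. \<forall>x\<in>P i. \<theta> i' (p j x) = q j (\<theta> i x))"

lemma equivariant_comp:
  assumes "equivariant I J P p Q q \<theta>" "equivariant I J Q q R r \<psi>"
  shows "equivariant I J P p R r (\<lambda>i x. \<psi> i (\<theta> i x))"
  using assms unfolding equivariant_def by simp

lemma equivariant_inv:
  assumes \<theta>: "equivariant I J P p Q q \<theta>"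
    and bij: "\<And>i. i \<in> I \<Longrightarrow> bij_betw (\<theta> i) (P i) (Q i)"
    and p: "\<And>i i' j x. \<lbrakk>i \<in> I; i' \<in> I; j \<in> J i i'; x \<in> P i\<rbrakk> \<Longrightarrow> p j x \<in> P i'"
  shows "equivariant I J Q q P p (\<lambda>i. inv_into (P i) (\<theta> i))"
  unfolding equivariant_def
proof (intro conjI ballI)
  show "inv_into (P i) (\<theta> i) y \<in> P i" if "i \<in> I" "y \<in> Q i" for i y
    using bij that by (metis bij_betw_def inv_into_into)
next
  fix i i' j y assume i: "i \<in> I" "i' \<in> I" and j: "j \<in> J i i'" and y: "y \<in> Q i"
  then obtain x where x: "x \<in> P i" "y = \<theta> i x"
    using bij unfolding bij_betw_def by blast
  have "q j y = \<theta> i' (p j x)" using \<theta> i j x unfolding equivariant_def by metis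
  then show "inv_into (P i') (\<theta> i') (q j y) = p j (inv_into (P i) (\<theta> i) y)"
    using bij_betw_inv_into_left[OF bij] i x p[OF i j x(1)] by simp
qed

lemma equivariant_pullback:
  assumes "equivariant I' J' P p Q q \<theta>" "\<And>i. i \<in> I \<Longrightarrow> F i \<in> I'"
    and "\<And>i i' j. \<lbrakk>i \<in> I; i' \<in> I; j \<in> J i i'\<rbrakk> \<Longrightarrow> F' j \<in> J' (F i) (F i')"
  shows "equivariant I J (\<lambda>i. P (F i)) (\<lambda>j. p (F' j)) (\<lambda>i. Q (F i)) (\<lambda>j. q (F' j)) (\<lambda>i. \<theta> (F i))"
  using assms unfolding equivariant_def by blast

text \<open>Each natural transformation between the two Set-valued functors comes from exactly one element of
  \<open>A\<close>.  Equality is required on the sets \<open>P i\<close> only, because the values of \<open>\<phi>\<close> elsewhere are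
  arbitrary.\<close>

definition parametrizes ::
  "'i set \<Rightarrow> ('i \<Rightarrow> 'i \<Rightarrow> 'j set) \<Rightarrow> ('i \<Rightarrow> 'x set) \<Rightarrow> ('j \<Rightarrow> 'x \<Rightarrow> 'x) \<Rightarrow>
   ('i \<Rightarrow> 'y set) \<Rightarrow> ('j \<Rightarrow> 'y \<Rightarrow> 'y) \<Rightarrow> 't set \<Rightarrow> ('t \<Rightarrow> 'i \<Rightarrow> 'x \<Rightarrow> 'y) \<Rightarrow> bool" where
  "parametrizes I J P p Q q A \<alpha> \<longleftrightarrow>
     (\<forall>a\<in>A. equivariant I J P p Q q (\<alpha> a)) \<and>
     (\<forall>\<phi>. equivariant I J P p Q q \<phi> \<longrightarrow> (\<exists>!a. a \<in> A \<and> (\<forall>i\<in>I. \<forall>x\<in>P i. \<phi> i x = \<alpha> a i x)))"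

text \<open>Natural isomorphisms \<open>\<theta> : P \<cong> Q\<close> and \<open>\<theta>' : P' \<cong> Q'\<close> make \<open>\<phi> \<mapsto> \<theta>' \<phi> \<theta>\<^sup>-\<^sup>1\<close> a bijection from the natural
  transformations \<open>P \<rightarrow> P'\<close> to the natural transformations \<open>Q \<rightarrow> Q'\<close>, and so relate the parameters.
  The graph is stated as a commuting square, which is free of inverses and can be pasted.\<close>

lemma transport_bijection:
  assumes A: "parametrizes I J P p P' p' A \<alpha>" and B: "parametrizes I J Q q Q' q' B \<beta>"
    and \<theta>: "equivariant I J P p Q q \<theta>" "\<And>i. i \<in> I \<Longrightarrow> bij_betw (\<theta> i) (P i) (Q i)"
    and p: "\<And>i i' j x. \<lbrakk>i \<in> I; i' \<in> I; j \<in> J i i'; x \<in> P i\<rbrakk> \<Longrightarrow> p j x \<in> P i'"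
    and \<theta>': "equivariant I J P' p' Q' q' \<theta>'" "\<And>i. i \<in> I \<Longrightarrow> bij_betw (\<theta>' i) (P' i) (Q' i)"
    and p': "\<And>i i' j x. \<lbrakk>i \<in> I; i' \<in> I; j \<in> J i i'; x \<in> P' i\<rbrakk> \<Longrightarrow> p' j x \<in> P' i'"
  shows "\<exists>\<Phi>. bij_betw \<Phi> A B \<and> (\<forall>a\<in>A. \<forall>b\<in>B. \<Phi> a = b \<longleftrightarrow>
    (\<forall>i\<in>I. \<forall>x\<in>P i. \<theta>' i (\<alpha> a i x) = \<beta> b i (\<theta> i x)))"
proof -
  define R where "R a b \<longleftrightarrow> (\<forall>i\<in>I. \<forall>x\<in>P i. \<theta>' i (\<alpha> a i x) = \<beta> b i (\<theta> i x))" for a b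
  have \<alpha>: "equivariant I J P p P' p' (\<alpha> a)" "\<And>i x. \<lbrakk>i \<in> I; x \<in> P i\<rbrakk> \<Longrightarrow> \<alpha> a i x \<in> P' i"
    if "a \<in> A" for a
    using A that unfolding parametrizes_def by (simp_all add: equivariant_def)
  have \<beta>: "equivariant I J Q q Q' q' (\<beta> b)" "\<And>i y. \<lbrakk>i \<in> I; y \<in> Q i\<rbrakk> \<Longrightarrow> \<beta> b i y \<in> Q' i"
    if "b \<in> B" for b
    using B that unfolding parametrizes_def by (simp_all add: equivariant_def)
  have \<theta>_Q: "\<theta> i x \<in> Q i" if "i \<in> I" "x \<in> P i" for i x
    using \<theta>(1) that unfolding equivariant_def by blast
  have forward: "\<exists>!b. b \<in> B \<and> R a b" if a: "a \<in> A" for a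
  proof -
    let ?\<psi> = "\<lambda>i y. \<theta>' i (\<alpha> a i (inv_into (P i) (\<theta> i) y))"
    have "equivariant I J Q q Q' q' ?\<psi>"
      by (rule equivariant_comp[OF equivariant_comp[OF equivariant_inv[OF \<theta> p] \<alpha>(1)[OF a]] \<theta>'(1)])
    then have "\<exists>!b. b \<in> B \<and> (\<forall>i\<in>I. \<forall>y\<in>Q i. ?\<psi> i y = \<beta> b i y)"
      using B unfolding parametrizes_def by simp
    moreover have "(\<forall>i\<in>I. \<forall>y\<in>Q i. ?\<psi> i y = \<beta> b i y) \<longleftrightarrow> R a b" for b
    proof -
      have "(\<forall>y\<in>Q i. ?\<psi> i y = \<beta> b i y) \<longleftrightarrow> (\<forall>x\<in>P i. \<theta>' i (\<alpha> a i x) = \<beta> b i (\<theta> i x))"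
        if "i \<in> I" for i
        using bij_betw_inv_into_left[OF \<theta>(2)[OF that]]
        by (simp flip: bij_betw_imp_surj_on[OF \<theta>(2)[OF that]])
      then show ?thesis by (simp add: R_def)
    qed
    ultimately show ?thesis by simp
  qed
  have backward: "\<exists>!a. a \<in> A \<and> R a b" if b: "b \<in> B" for b
  proof -
    let ?\<phi> = "\<lambda>i x. inv_into (P' i) (\<theta>' i) (\<beta> b i (\<theta> i x))"
    have "equivariant I J P p P' p' ?\<phi>"
      by (rule equivariant_comp[OF equivariant_comp[OF \<theta>(1) \<beta>(1)[OF b]] equivariant_inv[OF \<theta>' p']])
    then have "\<exists>!a. a \<in> A \<and> (\<forall>i\<in>I. \<forall>x\<in>P i. ?\<phi> i x = \<alpha> a i x)"
      using A unfolding parametrizes_def by simp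
    moreover have "(\<forall>i\<in>I. \<forall>x\<in>P i. ?\<phi> i x = \<alpha> a i x) \<longleftrightarrow> R a b" if a: "a \<in> A" for a
    proof -
      have "?\<phi> i x = \<alpha> a i x \<longleftrightarrow> \<theta>' i (\<alpha> a i x) = \<beta> b i (\<theta> i x)"
        if "i \<in> I" "x \<in> P i" for i x
        using bij_betw_inv_into_left[OF \<theta>'(2)] bij_betw_inv_into_right[OF \<theta>'(2)]
          \<alpha>(2)[OF a that] \<beta>(2)[OF b that(1) \<theta>_Q[OF that]] that by metis
      then show ?thesis by (simp add: R_def)
    qed
    ultimately show ?thesis by (simp cong: conj_cong)
  qed
  define \<Phi> where "\<Phi> a = (THE b. b \<in> B \<and> R a b)" for a
  have \<Phi>: "\<Phi> a \<in> B \<and> R a (\<Phi> a)" if "a \<in> A" for a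
    unfolding \<Phi>_def using theI'[OF forward[OF that]] .
  have graph: "\<Phi> a = b \<longleftrightarrow> R a b" if "a \<in> A" "b \<in> B" for a b
    using \<Phi>[OF that(1)] forward[OF that(1)] that(2) by blast
  have "bij_betw \<Phi> A B"
  proof (rule bij_betw_imageI)
    show "inj_on \<Phi> A"
    proof (rule inj_onI)
      fix a a' assume a: "a \<in> A" "a' \<in> A" and eq: "\<Phi> a = \<Phi> a'"
      have "R a (\<Phi> a)" "R a' (\<Phi> a)" using \<Phi>[OF a(1)] \<Phi>[OF a(2)] eq by simp_all
      then show "a = a'" using a backward[of "\<Phi> a"] \<Phi>[OF a(1)] by blast
    qed
    show "\<Phi> ` A = B"
    proof (intro equalityI subsetI)
      fix b assume b: "b \<in> B"
      then obtain a where a: "a \<in> A" "R a b" using backward[OF b] by (elim ex1E conjE)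
      then show "b \<in> \<Phi> ` A" using graph[OF a(1) b] by (metis imageI)
    qed (use \<Phi> in auto)
  qed
  moreover have "\<forall>a\<in>A. \<forall>b\<in>B. \<Phi> a = b \<longleftrightarrow> R a b" using graph by simp
  ultimately show ?thesis unfolding R_def by (intro exI conjI)
qed

section \<open>The three hom-functors of a two-variable adjunction\<close>

definition triples :: "('ko, 'ka) cat \<Rightarrow> ('mo, 'ma) cat \<Rightarrow> ('no, 'na) cat \<Rightarrow> ('ko \<times> 'mo \<times> 'no) set"
  where "triples \<K> \<M> \<N> = Obj \<K> \<times> Obj \<M> \<times> Obj \<N>"

text \<open>The arrows of \<open>K\<^sup>o\<^sup>p \<times> M\<^sup>o\<^sup>p \<times> N\<close>, with \<open>triples\<close> as objects.\<close>

definition triple_arrows ::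
  "('ko, 'ka) cat \<Rightarrow> ('mo, 'ma) cat \<Rightarrow> ('no, 'na) cat \<Rightarrow> 'ko \<times> 'mo \<times> 'no \<Rightarrow> 'ko \<times> 'mo \<times> 'no \<Rightarrow>
   ('ka \<times> 'ma \<times> 'na) set" where
  "triple_arrows \<K> \<M> \<N> = (\<lambda>(k, m, n) (k', m', n'). Hom \<K> k' k \<times> Hom \<M> m' m \<times> Hom \<N> n n')"

context
  fixes \<K> :: "('ko, 'ka) cat" and \<M> :: "('mo, 'ma) cat" and \<N> :: "('no, 'na) cat"
    and X :: "('ko, 'ka, 'mo, 'ma, 'no, 'na) two_var_adj"
begin

definition tensor_hom where "tensor_hom = (\<lambda>(k, m, n). Hom \<N> (fob (tensor X) (k, m)) n)"
definition l_hom where "l_hom = (\<lambda>(k, m, n). Hom \<M> m (fob (hom_l X) (k, n)))"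
definition r_hom where "r_hom = (\<lambda>(k, m, n). Hom \<K> k (fob (hom_r X) (m, n)))"

text \<open>
  An arrow acts by composition on both sides.  The composites in \<open>l_act\<close> and \<open>r_act\<close> are bracketed
  to the left because this is what a composite bracketed to the right in the opposite category
  unfolds to.\<close>

definition tensor_act where
  "tensor_act = (\<lambda>(u, v, w) f. w \<cdot>\<^bsub>\<N>\<^esub> f \<cdot>\<^bsub>\<N>\<^esub> far (tensor X) (u, v))"
definition l_act where
  "l_act = (\<lambda>(u, v, w) g. (far (hom_l X) (u, w) \<cdot>\<^bsub>\<M>\<^esub> g) \<cdot>\<^bsub>\<M>\<^esub> v)"
definition r_act where
  "r_act = (\<lambda>(u, v, w) h. (far (hom_r X) (v, w) \<cdot>\<^bsub>\<K>\<^esub> h) \<cdot>\<^bsub>\<K>\<^esub> u)"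

end

lemmas triple_defs = triples_def triple_arrows_def tensor_hom_def l_hom_def r_hom_def
  tensor_act_def l_act_def r_act_def

context two_variable_adjunction
begin

lemma tensor_act_closed:
  assumes "j \<in> triple_arrows \<K> \<M> \<N> i i'" "f \<in> tensor_hom \<N> X i"
  shows "tensor_act \<N> X j f \<in> tensor_hom \<N> X i'"
proof -
  obtain k m n k' m' n' u v w where ij: "i = (k, m, n)" "i' = (k', m', n')" "j = (u, v, w)"
    by (metis prod_cases3)
  have "far (tensor X) (u, v) \<in> Hom \<N> (fob (tensor X) (k', m')) (fob (tensor X) (k, m))"
    by (rule tensor.far_Hom) (use assms ij in \<open>simp add: triple_defs\<close>)
  from catN.Comp_Hom[OF catN.Comp_Hom[OF this]] show ?thesis
    using assms ij by (auto simp: triple_defs)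
qed

lemma l_act_closed:
  assumes "j \<in> triple_arrows \<K> \<M> \<N> i i'" "g \<in> l_hom \<M> X i"
  shows "l_act \<M> X j g \<in> l_hom \<M> X i'"
proof -
  obtain k m n k' m' n' u v w where ij: "i = (k, m, n)" "i' = (k', m', n')" "j = (u, v, w)"
    by (metis prod_cases3)
  have "far (hom_l X) (u, w) \<in> Hom \<M> (fob (hom_l X) (k, n)) (fob (hom_l X) (k', n'))"
    by (rule hom_l.far_Hom) (use assms ij in \<open>simp add: triple_defs\<close>)
  from catM.Comp_Hom[OF _ catM.Comp_Hom[OF _ this]] show ?thesis
    using assms ij by (auto simp: triple_defs)
qed

lemma equivariant_iso_l:
  "equivariant (triples \<K> \<M> \<N>) (triple_arrows \<K> \<M> \<N>)
     (tensor_hom \<N> X) (tensor_act \<N> X) (l_hom \<M> X) (l_act \<M> X) (\<lambda>(k, m, n). iso_l X k m n)"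
proof -
  have "(far (hom_l X) (u, w) \<cdot>\<^bsub>\<M>\<^esub> g) \<cdot>\<^bsub>\<M>\<^esub> v = far (hom_l X) (u, w) \<cdot>\<^bsub>\<M>\<^esub> g \<cdot>\<^bsub>\<M>\<^esub> v"
    if "u \<in> Hom \<K> k' k" "v \<in> Hom \<M> m' m" "w \<in> Hom \<N> n n'" "g \<in> Hom \<M> m (fob (hom_l X) (k, n))"
    for k k' m m' n n' u v w g
    using catM.Comp_assoc[OF that(2,4) hom_l.far_Hom[of "(u, w)" "(k, n)" "(k', n')"]] that by simp
  then show ?thesis
    unfolding equivariant_def by (auto simp: triple_defs iso_l_Hom iso_l_natural)
qed

lemma equivariant_iso_r:
  "equivariant (triples \<K> \<M> \<N>) (triple_arrows \<K> \<M> \<N>)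
     (l_hom \<M> X) (l_act \<M> X) (r_hom \<K> X) (r_act \<K> X) (\<lambda>(k, m, n). iso_r X k m n)"
proof -
  have "(far (hom_l X) (u, w) \<cdot>\<^bsub>\<M>\<^esub> g) \<cdot>\<^bsub>\<M>\<^esub> v = far (hom_l X) (u, w) \<cdot>\<^bsub>\<M>\<^esub> g \<cdot>\<^bsub>\<M>\<^esub> v"
    if "u \<in> Hom \<K> k' k" "v \<in> Hom \<M> m' m" "w \<in> Hom \<N> n n'" "g \<in> Hom \<M> m (fob (hom_l X) (k, n))"
    for k k' m m' n n' u v w g
    using catM.Comp_assoc[OF that(2,4) hom_l.far_Hom[of "(u, w)" "(k, n)" "(k', n')"]] that by simp
  moreover have "(far (hom_r X) (v, w) \<cdot>\<^bsub>\<K>\<^esub> h) \<cdot>\<^bsub>\<K>\<^esub> u = far (hom_r X) (v, w) \<cdot>\<^bsub>\<K>\<^esub> h \<cdot>\<^bsub>\<K>\<^esub> u"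
    if "u \<in> Hom \<K> k' k" "v \<in> Hom \<M> m' m" "w \<in> Hom \<N> n n'" "h \<in> Hom \<K> k (fob (hom_r X) (m, n))"
    for k k' m m' n n' u v w h
    using catK.Comp_assoc[OF that(1,4) hom_r.far_Hom[of "(v, w)" "(m, n)" "(m', n')"]] that by simp
  ultimately show ?thesis
    unfolding equivariant_def by (auto simp: triple_defs iso_r_Hom iso_r_natural)
qed

lemma bij_iso_l:
  "i \<in> triples \<K> \<M> \<N> \<Longrightarrow> bij_betw ((\<lambda>(k, m, n). iso_l X k m n) i) (tensor_hom \<N> X i) (l_hom \<M> X i)"
  by (auto simp: triple_defs iso_l_bij)

lemma bij_iso_r:
  "i \<in> triples \<K> \<M> \<N> \<Longrightarrow> bij_betw ((\<lambda>(k, m, n). iso_r X k m n) i) (l_hom \<M> X i) (r_hom \<K> X i)"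
  by (auto simp: triple_defs iso_r_bij)

end

section \<open>Two-variable mates\<close>

locale two_variable_mates =
  X: two_variable_adjunction \<K> \<M> \<N> X + X': two_variable_adjunction \<K>' \<M>' \<N>' X' +
  K: is_functor \<K> \<K>' K + M: is_functor \<M> \<M>' M + N: is_functor \<N> \<N>' N
  for \<K> :: "('ko, 'ka) cat" and \<M> :: "('mo, 'ma) cat" and \<N> :: "('no, 'na) cat"
    and \<K>' :: "('ko', 'ka') cat" and \<M>' :: "('mo', 'ma') cat" and \<N>' :: "('no', 'na') cat"
    and X :: "('ko, 'ka, 'mo, 'ma, 'no, 'na) two_var_adj"
    and X' :: "('ko', 'ka', 'mo', 'ma', 'no', 'na') two_var_adj"
    and K :: "('ko, 'ka, 'ko', 'ka') fnctr"
    and M :: "('mo, 'ma, 'mo', 'ma') fnctr"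
    and N :: "('no, 'na, 'no', 'na') fnctr"
begin

abbreviation Lam where
  "Lam \<equiv> nat_trans (prod_cat \<K> \<M>) \<N>' (tensor X' \<odot> prod_fnctr K M) (N \<odot> tensor X)"
abbreviation Rl where
  "Rl \<equiv> nat_trans (prod_cat (op_cat \<K>) \<N>) \<M>' (M \<odot> hom_l X) (hom_l X' \<odot> prod_fnctr K N)"
abbreviation Rr where
  "Rr \<equiv> nat_trans (prod_cat (op_cat \<M>) \<N>) \<K>' (K \<odot> hom_r X) (hom_r X' \<odot> prod_fnctr M N)"

abbreviation ob where "ob \<equiv> \<lambda>(k, m, n). (fob K k, fob M m, fob N n)"
abbreviation ar where "ar \<equiv> \<lambda>(u, v, w). (far K u, far M v, far N w)"

abbreviation equivariant_maps where
  "equivariant_maps P p P' p' \<equiv> equivariant (triples \<K> \<M> \<N>) (triple_arrows \<K> \<M> \<N>)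
     P p (\<lambda>i. P' (ob i)) (\<lambda>j. p' (ar j))"

abbreviation tensor_maps where
  "tensor_maps \<equiv> equivariant_maps (tensor_hom \<N> X) (tensor_act \<N> X)
     (tensor_hom \<N>' X') (tensor_act \<N>' X')"
abbreviation l_maps where
  "l_maps \<equiv> equivariant_maps (l_hom \<M> X) (l_act \<M> X) (l_hom \<M>' X') (l_act \<M>' X')"
abbreviation r_maps where
  "r_maps \<equiv> equivariant_maps (r_hom \<K> X) (r_act \<K> X) (r_hom \<K>' X') (r_act \<K>' X')"

text \<open>The Yoneda argument applies to \<open>\<lambda>\<close> as it stands.  The transformations \<open>\<rho>\<^sup>l\<close> and \<open>\<rho>\<^sup>r\<close> have the fixed
  functors in their source, and are therefore read in the opposite categories, where they point from
  \<open>hom'\<close> to \<open>hom\<close>.\<close>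

lemma tensor_setting:
  "hom_family_setting (prod_cat \<K> \<M>) \<N> \<N>' (tensor X) (tensor X' \<odot> prod_fnctr K M) N"
  by (intro hom_family_setting.intro X.tensor.is_functor_axioms N.is_functor_axioms
      is_functor_comp[OF is_functor_prod X'.tensor.is_functor_axioms]
      K.is_functor_axioms M.is_functor_axioms)

lemma l_setting:
  "hom_family_setting (op_cat (prod_cat (op_cat \<K>) \<N>)) (op_cat \<M>) (op_cat \<M>')
     (hom_l X) (hom_l X' \<odot> prod_fnctr K N) M"
  by (intro hom_family_setting.intro is_functor_op X.hom_l.is_functor_axioms
      is_functor_comp[OF is_functor_prod X'.hom_l.is_functor_axioms]
      K.is_functor_axioms M.is_functor_axioms N.is_functor_axioms)

lemma r_setting:
  "hom_family_setting (op_cat (prod_cat (op_cat \<M>) \<N>)) (op_cat \<K>) (op_cat \<K>')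
     (hom_r X) (hom_r X' \<odot> prod_fnctr M N) K"
  by (intro hom_family_setting.intro is_functor_op X.hom_r.is_functor_axioms
      is_functor_comp[OF is_functor_prod X'.hom_r.is_functor_axioms]
      K.is_functor_axioms M.is_functor_axioms N.is_functor_axioms)

text \<open>The natural families of the Yoneda argument and the equivariant maps are given by the same
  conditions; only the grouping of the three indices differs.\<close>

lemma tensor_maps_iff:
  "hom_family (prod_cat \<K> \<M>) \<N> \<N>' (tensor X) (tensor X' \<odot> prod_fnctr K M) N
     (\<lambda>(k, m) n. \<phi> (k, m, n)) \<longleftrightarrow> tensor_maps \<phi>"
  unfolding hom_family_def equivariant_def triple_defs
  by (simp, intro conj_cong iffI ballI; blast)

lemma l_maps_iff:
  "hom_family (op_cat (prod_cat (op_cat \<K>) \<N>)) (op_cat \<M>) (op_cat \<M>')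
     (hom_l X) (hom_l X' \<odot> prod_fnctr K N) M (\<lambda>(k, n) m. \<phi> (k, m, n)) \<longleftrightarrow> l_maps \<phi>"
  unfolding hom_family_def equivariant_def triple_defs
  by (simp, intro conj_cong iffI ballI; blast)

lemma r_maps_iff:
  "hom_family (op_cat (prod_cat (op_cat \<M>) \<N>)) (op_cat \<K>) (op_cat \<K>')
     (hom_r X) (hom_r X' \<odot> prod_fnctr M N) K (\<lambda>(m, n) k. \<phi> (k, m, n)) \<longleftrightarrow> r_maps \<phi>"
  unfolding hom_family_def equivariant_def triple_defs
  by (simp, intro conj_cong iffI ballI; blast)

lemma Lam_parametrizes:
  "parametrizes (triples \<K> \<M> \<N>) (triple_arrows \<K> \<M> \<N>) (tensor_hom \<N> X) (tensor_act \<N> X)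
     (\<lambda>i. tensor_hom \<N>' X' (ob i)) (\<lambda>j. tensor_act \<N>' X' (ar j)) Lam
     (\<lambda>lam (k, m, n) f. far N f \<cdot>\<^bsub>\<N>'\<^esub> lam (k, m))"
  unfolding parametrizes_def tensor_maps_iff[symmetric]
proof (intro conjI ballI allI impI)
  fix lam assume "lam \<in> Lam"
  from hom_family_setting.nat_trans_hom_family[OF tensor_setting this]
  show "hom_family (prod_cat \<K> \<M>) \<N> \<N>' (tensor X) (tensor X' \<odot> prod_fnctr K M) N
      (\<lambda>(k, m) n. case (k, m, n) of (k, m, n) \<Rightarrow> \<lambda>f. far N f \<cdot>\<^bsub>\<N>'\<^esub> lam (k, m))"
    by (simp add: split_def)
next
  fix \<phi> assume "hom_family (prod_cat \<K> \<M>) \<N> \<N>' (tensor X) (tensor X' \<odot> prod_fnctr K M) N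
    (\<lambda>(k, m) n. \<phi> (k, m, n))"
  from hom_family_setting.hom_family_unique_representation[OF tensor_setting this]
  show "\<exists>!lam. lam \<in> Lam \<and> (\<forall>i\<in>triples \<K> \<M> \<N>. \<forall>f\<in>tensor_hom \<N> X i.
      \<phi> i f = (case i of (k, m, n) \<Rightarrow> \<lambda>f. far N f \<cdot>\<^bsub>\<N>'\<^esub> lam (k, m)) f)"
    by (simp add: triple_defs)
qed

lemma Rl_parametrizes:
  "parametrizes (triples \<K> \<M> \<N>) (triple_arrows \<K> \<M> \<N>) (l_hom \<M> X) (l_act \<M> X)
     (\<lambda>i. l_hom \<M>' X' (ob i)) (\<lambda>j. l_act \<M>' X' (ar j)) Rl
     (\<lambda>\<rho>l (k, m, n) g. \<rho>l (k, n) \<cdot>\<^bsub>\<M>'\<^esub> far M g)"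
  unfolding parametrizes_def l_maps_iff[symmetric]
proof (intro conjI ballI allI impI)
  fix \<rho>l assume "\<rho>l \<in> Rl"
  from hom_family_setting.nat_trans_hom_family[OF l_setting, unfolded nat_trans_op, OF this]
  show "hom_family (op_cat (prod_cat (op_cat \<K>) \<N>)) (op_cat \<M>) (op_cat \<M>') (hom_l X)
      (hom_l X' \<odot> prod_fnctr K N) M
      (\<lambda>(k, n) m. case (k, m, n) of (k, m, n) \<Rightarrow> \<lambda>g. \<rho>l (k, n) \<cdot>\<^bsub>\<M>'\<^esub> far M g)"
    by (simp add: split_def)
next
  fix \<phi> assume "hom_family (op_cat (prod_cat (op_cat \<K>) \<N>)) (op_cat \<M>) (op_cat \<M>') (hom_l X)
    (hom_l X' \<odot> prod_fnctr K N) M (\<lambda>(k, n) m. \<phi> (k, m, n))"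
  from hom_family_setting.hom_family_unique_representation[OF l_setting this]
  have "\<exists>!\<rho>l. \<rho>l \<in> Rl \<and> (\<forall>k\<in>Obj \<K>. \<forall>n\<in>Obj \<N>. \<forall>m\<in>Obj \<M>.
      \<forall>g\<in>Hom \<M> m (fob (hom_l X) (k, n)). \<phi> (k, m, n) g = \<rho>l (k, n) \<cdot>\<^bsub>\<M>'\<^esub> far M g)"
    by (simp add: nat_trans_op)
  moreover have "(\<forall>k\<in>Obj \<K>. \<forall>n\<in>Obj \<N>. \<forall>m\<in>Obj \<M>. \<forall>g\<in>Hom \<M> m (fob (hom_l X) (k, n)).
        \<phi> (k, m, n) g = \<rho>l (k, n) \<cdot>\<^bsub>\<M>'\<^esub> far M g) \<longleftrightarrow>
      (\<forall>i\<in>triples \<K> \<M> \<N>. \<forall>g\<in>l_hom \<M> X i.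
        \<phi> i g = (case i of (k, m, n) \<Rightarrow> \<lambda>g. \<rho>l (k, n) \<cdot>\<^bsub>\<M>'\<^esub> far M g) g)" for \<rho>l
    by (auto simp: triple_defs)
  ultimately show "\<exists>!\<rho>l. \<rho>l \<in> Rl \<and> (\<forall>i\<in>triples \<K> \<M> \<N>. \<forall>g\<in>l_hom \<M> X i.
      \<phi> i g = (case i of (k, m, n) \<Rightarrow> \<lambda>g. \<rho>l (k, n) \<cdot>\<^bsub>\<M>'\<^esub> far M g) g)"
    by simp
qed

lemma Rr_parametrizes:
  "parametrizes (triples \<K> \<M> \<N>) (triple_arrows \<K> \<M> \<N>) (r_hom \<K> X) (r_act \<K> X)
     (\<lambda>i. r_hom \<K>' X' (ob i)) (\<lambda>j. r_act \<K>' X' (ar j)) Rr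
     (\<lambda>\<rho>r (k, m, n) h. \<rho>r (m, n) \<cdot>\<^bsub>\<K>'\<^esub> far K h)"
  unfolding parametrizes_def r_maps_iff[symmetric]
proof (intro conjI ballI allI impI)
  fix \<rho>r assume "\<rho>r \<in> Rr"
  from hom_family_setting.nat_trans_hom_family[OF r_setting, unfolded nat_trans_op, OF this]
  show "hom_family (op_cat (prod_cat (op_cat \<M>) \<N>)) (op_cat \<K>) (op_cat \<K>') (hom_r X)
      (hom_r X' \<odot> prod_fnctr M N) K
      (\<lambda>(m, n) k. case (k, m, n) of (k, m, n) \<Rightarrow> \<lambda>h. \<rho>r (m, n) \<cdot>\<^bsub>\<K>'\<^esub> far K h)"
    by (simp add: split_def)
next
  fix \<phi> assume "hom_family (op_cat (prod_cat (op_cat \<M>) \<N>)) (op_cat \<K>) (op_cat \<K>') (hom_r X)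
    (hom_r X' \<odot> prod_fnctr M N) K (\<lambda>(m, n) k. \<phi> (k, m, n))"
  from hom_family_setting.hom_family_unique_representation[OF r_setting this]
  have "\<exists>!\<rho>r. \<rho>r \<in> Rr \<and> (\<forall>m\<in>Obj \<M>. \<forall>n\<in>Obj \<N>. \<forall>k\<in>Obj \<K>.
      \<forall>h\<in>Hom \<K> k (fob (hom_r X) (m, n)). \<phi> (k, m, n) h = \<rho>r (m, n) \<cdot>\<^bsub>\<K>'\<^esub> far K h)"
    by (simp add: nat_trans_op)
  moreover have "(\<forall>m\<in>Obj \<M>. \<forall>n\<in>Obj \<N>. \<forall>k\<in>Obj \<K>. \<forall>h\<in>Hom \<K> k (fob (hom_r X) (m, n)).
        \<phi> (k, m, n) h = \<rho>r (m, n) \<cdot>\<^bsub>\<K>'\<^esub> far K h) \<longleftrightarrow>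
      (\<forall>i\<in>triples \<K> \<M> \<N>. \<forall>h\<in>r_hom \<K> X i.
        \<phi> i h = (case i of (k, m, n) \<Rightarrow> \<lambda>h. \<rho>r (m, n) \<cdot>\<^bsub>\<K>'\<^esub> far K h) h)" for \<rho>r
    by (auto simp: triple_defs)
  ultimately show "\<exists>!\<rho>r. \<rho>r \<in> Rr \<and> (\<forall>i\<in>triples \<K> \<M> \<N>. \<forall>h\<in>r_hom \<K> X i.
      \<phi> i h = (case i of (k, m, n) \<Rightarrow> \<lambda>h. \<rho>r (m, n) \<cdot>\<^bsub>\<K>'\<^esub> far K h) h)"
    by simp
qed

lemma ob_triples: "i \<in> triples \<K> \<M> \<N> \<Longrightarrow> ob i \<in> triples \<K>' \<M>' \<N>'"
  by (auto simp: triples_def K.fob_Obj M.fob_Obj N.fob_Obj)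

lemma ar_triple_arrows:
  "j \<in> triple_arrows \<K> \<M> \<N> i i' \<Longrightarrow> ar j \<in> triple_arrows \<K>' \<M>' \<N>' (ob i) (ob i')"
  by (auto simp: triple_arrows_def K.far_Hom M.far_Hom N.far_Hom split: prod.splits)

text \<open>Each square says that two transformations
  induce the same map of hom-sets up to the isomorphisms of the two-variable adjunctions.\<close>

definition square_K where
  "square_K lam \<rho>l \<longleftrightarrow> (\<forall>k\<in>Obj \<K>. \<forall>m\<in>Obj \<M>. \<forall>n\<in>Obj \<N>. \<forall>f\<in>Hom \<N> (fob (tensor X) (k, m)) n.
     iso_l X' (fob K k) (fob M m) (fob N n) (far N f \<cdot>\<^bsub>\<N>'\<^esub> lam (k, m)) =
     \<rho>l (k, n) \<cdot>\<^bsub>\<M>'\<^esub> far M (iso_l X k m n f))"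

definition square_M where
  "square_M lam \<rho>r \<longleftrightarrow> (\<forall>k\<in>Obj \<K>. \<forall>m\<in>Obj \<M>. \<forall>n\<in>Obj \<N>. \<forall>f\<in>Hom \<N> (fob (tensor X) (k, m)) n.
     iso_r X' (fob K k) (fob M m) (fob N n)
       (iso_l X' (fob K k) (fob M m) (fob N n) (far N f \<cdot>\<^bsub>\<N>'\<^esub> lam (k, m))) =
     \<rho>r (m, n) \<cdot>\<^bsub>\<K>'\<^esub> far K (iso_r X k m n (iso_l X k m n f)))"

definition square_N where
  "square_N \<rho>l \<rho>r \<longleftrightarrow> (\<forall>k\<in>Obj \<K>. \<forall>m\<in>Obj \<M>. \<forall>n\<in>Obj \<N>. \<forall>g\<in>Hom \<M> m (fob (hom_l X) (k, n)).
     iso_r X' (fob K k) (fob M m) (fob N n) (\<rho>l (k, n) \<cdot>\<^bsub>\<M>'\<^esub> far M g) =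
     \<rho>r (m, n) \<cdot>\<^bsub>\<K>'\<^esub> far K (iso_r X k m n g))"

lemma square_K_bijection:
  "\<exists>\<Phi>. bij_betw \<Phi> Lam Rl \<and> (\<forall>lam\<in>Lam. \<forall>\<rho>l\<in>Rl. \<Phi> lam = \<rho>l \<longleftrightarrow> square_K lam \<rho>l)"
  using transport_bijection[OF Lam_parametrizes Rl_parametrizes X.equivariant_iso_l X.bij_iso_l
      X.tensor_act_closed
      equivariant_pullback[OF X'.equivariant_iso_l ob_triples ar_triple_arrows]
      X'.bij_iso_l[OF ob_triples] X'.tensor_act_closed[OF ar_triple_arrows]]
  unfolding square_K_def by (simp add: triple_defs)

lemma square_N_bijection:
  "\<exists>\<Psi>. bij_betw \<Psi> Rl Rr \<and> (\<forall>\<rho>l\<in>Rl. \<forall>\<rho>r\<in>Rr. \<Psi> \<rho>l = \<rho>r \<longleftrightarrow> square_N \<rho>l \<rho>r)"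
  using transport_bijection[OF Rl_parametrizes Rr_parametrizes X.equivariant_iso_r X.bij_iso_r
      X.l_act_closed
      equivariant_pullback[OF X'.equivariant_iso_r ob_triples ar_triple_arrows]
      X'.bij_iso_r[OF ob_triples] X'.l_act_closed[OF ar_triple_arrows]]
  unfolding square_N_def by (simp add: triple_defs)

text \<open>The squares of \<open>iso_l\<close> and of \<open>iso_r\<close> paste to the square of the composite.  In the other
  direction the square of \<open>iso_l\<close> can be cancelled, because every \<open>g : m \<rightarrow> hom\<^sub>l(k, n)\<close> is of the form
  \<open>iso_l f\<close>.\<close>

lemma square_M_iff_square_N:
  assumes K: "square_K lam \<rho>l"
  shows "square_M lam \<rho>r \<longleftrightarrow> square_N \<rho>l \<rho>r"
proof -
  have "(\<forall>g\<in>Hom \<M> m (fob (hom_l X) (k, n)). S g) \<longleftrightarrow>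
      (\<forall>f\<in>Hom \<N> (fob (tensor X) (k, m)) n. S (iso_l X k m n f))"
    if "k \<in> Obj \<K>" "m \<in> Obj \<M>" "n \<in> Obj \<N>" for k m n S
    by (simp flip: bij_betw_imp_surj_on[OF X.iso_l_bij[OF that]])
  then show ?thesis
    using K unfolding square_K_def square_M_def square_N_def by simp
qed

text \<open>For a fixed variable, the transposes in \<open>mates_iff_transpose\<close> are the isomorphisms of the
  two-variable adjunctions, and the squares of one-variable mates, taken for all values of the fixed
  variable, make up the square in three variables.  Restricting a two-variable transformation gives
  one between the functors required for mates because the functors \<open>K\<close>, \<open>M\<close> and \<open>N\<close> preserve the
  identity of the fixed object.\<close>

lemma mates_K_iff_square:
  assumes lam: "lam \<in> Lam" and \<rho>l: "\<rho>l \<in> Rl"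
  shows "(\<forall>k\<in>Obj \<K>. mates \<M> \<N> (adj_fix_K \<K> \<M> \<N> X k) \<M>' \<N>' (adj_fix_K \<K>' \<M>' \<N>' X' (fob K k)) M N
      (\<lambda>m\<in>Obj \<M>. lam (k, m)) (\<lambda>n\<in>Obj \<N>. \<rho>l (k, n))) \<longleftrightarrow> square_K lam \<rho>l"
proof -
  have "mates \<M> \<N> (adj_fix_K \<K> \<M> \<N> X k) \<M>' \<N>' (adj_fix_K \<K>' \<M>' \<N>' X' (fob K k)) M N
      (\<lambda>m\<in>Obj \<M>. lam (k, m)) (\<lambda>n\<in>Obj \<N>. \<rho>l (k, n)) \<longleftrightarrow>
    (\<forall>m\<in>Obj \<M>. \<forall>n\<in>Obj \<N>. \<forall>f\<in>Hom \<N> (fob (tensor X) (k, m)) n.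
     iso_l X' (fob K k) (fob M m) (fob N n) (far N f \<cdot>\<^bsub>\<N>'\<^esub> lam (k, m)) =
     \<rho>l (k, n) \<cdot>\<^bsub>\<M>'\<^esub> far M (iso_l X k m n f))" if k: "k \<in> Obj \<K>" for k
  proof -
    let ?J = "adj_fix_K \<K> \<M> \<N> X k" and ?J' = "adj_fix_K \<K>' \<M>' \<N>' X' (fob K k)"
    note k' = K.fob_Obj[OF k]
    have "(\<lambda>m\<in>Obj \<M>. lam (k, m)) \<in> nat_trans \<M> \<N>' (ladj ?J' \<odot> M) (N \<odot> ladj ?J)"
      using nat_trans_fix_fst[OF X.catK.category_axioms lam k]
      by (simp add: adj_fix_K_def adj_of_hom_iso_def fix_fst_def comp_fnctr_def prod_fnctr_def
          comp_def K.far_Ident[OF k])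
    moreover have "(\<lambda>n\<in>Obj \<N>. \<rho>l (k, n)) \<in> nat_trans \<N> \<M>' (M \<odot> radj ?J) (radj ?J' \<odot> N)"
      using nat_trans_fix_fst[OF X.catK.category_op_cat \<rho>l, of k] k
      by (simp add: adj_fix_K_def adj_of_hom_iso_def fix_fst_def comp_fnctr_def prod_fnctr_def
          comp_def K.far_Ident[OF k])
    ultimately have "mates \<M> \<N> ?J \<M>' \<N>' ?J' M N (\<lambda>m\<in>Obj \<M>. lam (k, m)) (\<lambda>n\<in>Obj \<N>. \<rho>l (k, n)) \<longleftrightarrow>
      (\<forall>m\<in>Obj \<M>. \<forall>n\<in>Obj \<N>. \<forall>f\<in>Hom \<N> (fob (ladj ?J) m) n.
         far (radj ?J') (far N f \<cdot>\<^bsub>\<N>'\<^esub> (\<lambda>m\<in>Obj \<M>. lam (k, m)) m) \<cdot>\<^bsub>\<M>'\<^esub> unit ?J' (fob M m) =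
         (\<lambda>n\<in>Obj \<N>. \<rho>l (k, n)) n \<cdot>\<^bsub>\<M>'\<^esub> far M (far (radj ?J) f \<cdot>\<^bsub>\<M>\<^esub> unit ?J m))"
      by (rule mates_iff_transpose[OF X.adjunction_adj_fix_K[OF k] X'.adjunction_adj_fix_K[OF k']
            M.is_functor_axioms N.is_functor_axioms])
    moreover have "far (radj ?J') (far N f \<cdot>\<^bsub>\<N>'\<^esub> lam (k, m)) \<cdot>\<^bsub>\<M>'\<^esub> unit ?J' (fob M m) =
        iso_l X' (fob K k) (fob M m) (fob N n) (far N f \<cdot>\<^bsub>\<N>'\<^esub> lam (k, m))"
      if "m \<in> Obj \<M>" "n \<in> Obj \<N>" "f \<in> Hom \<N> (fob (tensor X) (k, m)) n" for m n f
      using X'.catN.Comp_Hom[OF _ N.far_Hom[OF that(3)]] nat_trans_Hom[OF lam, of "(k, m)"] k k' that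
      by (simp add: X'.transpose_adj_fix_K M.fob_Obj N.fob_Obj)
    moreover have "fob (ladj ?J) m = fob (tensor X) (k, m)" for m
      by (simp add: adj_fix_K_def adj_of_hom_iso_def)
    ultimately show ?thesis
      using k by (simp add: X.transpose_adj_fix_K cong: ball_cong)
  qed
  then show ?thesis unfolding square_K_def by simp
qed

lemma mates_M_iff_square:
  assumes lam: "lam \<in> Lam" and \<rho>r: "\<rho>r \<in> Rr"
  shows "(\<forall>m\<in>Obj \<M>. mates \<K> \<N> (adj_fix_M \<K> \<M> \<N> X m) \<K>' \<N>' (adj_fix_M \<K>' \<M>' \<N>' X' (fob M m)) K N
      (\<lambda>k\<in>Obj \<K>. lam (k, m)) (\<lambda>n\<in>Obj \<N>. \<rho>r (m, n))) \<longleftrightarrow> square_M lam \<rho>r"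
proof -
  have "mates \<K> \<N> (adj_fix_M \<K> \<M> \<N> X m) \<K>' \<N>' (adj_fix_M \<K>' \<M>' \<N>' X' (fob M m)) K N
      (\<lambda>k\<in>Obj \<K>. lam (k, m)) (\<lambda>n\<in>Obj \<N>. \<rho>r (m, n)) \<longleftrightarrow>
    (\<forall>k\<in>Obj \<K>. \<forall>n\<in>Obj \<N>. \<forall>f\<in>Hom \<N> (fob (tensor X) (k, m)) n.
     iso_r X' (fob K k) (fob M m) (fob N n)
       (iso_l X' (fob K k) (fob M m) (fob N n) (far N f \<cdot>\<^bsub>\<N>'\<^esub> lam (k, m))) =
     \<rho>r (m, n) \<cdot>\<^bsub>\<K>'\<^esub> far K (iso_r X k m n (iso_l X k m n f)))" if m: "m \<in> Obj \<M>" for m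
  proof -
    let ?J = "adj_fix_M \<K> \<M> \<N> X m" and ?J' = "adj_fix_M \<K>' \<M>' \<N>' X' (fob M m)"
    note m' = M.fob_Obj[OF m]
    have "(\<lambda>k\<in>Obj \<K>. lam (k, m)) \<in> nat_trans \<K> \<N>' (ladj ?J' \<odot> K) (N \<odot> ladj ?J)"
      using nat_trans_fix_snd[OF X.catM.category_axioms lam m]
      by (simp add: adj_fix_M_def adj_of_hom_iso_def fix_snd_def comp_fnctr_def prod_fnctr_def
          comp_def M.far_Ident[OF m])
    moreover have "(\<lambda>n\<in>Obj \<N>. \<rho>r (m, n)) \<in> nat_trans \<N> \<K>' (K \<odot> radj ?J) (radj ?J' \<odot> N)"
      using nat_trans_fix_fst[OF X.catM.category_op_cat \<rho>r, of m] m
      by (simp add: adj_fix_M_def adj_of_hom_iso_def fix_fst_def comp_fnctr_def prod_fnctr_def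
          comp_def M.far_Ident[OF m])
    ultimately have "mates \<K> \<N> ?J \<K>' \<N>' ?J' K N (\<lambda>k\<in>Obj \<K>. lam (k, m)) (\<lambda>n\<in>Obj \<N>. \<rho>r (m, n)) \<longleftrightarrow>
      (\<forall>k\<in>Obj \<K>. \<forall>n\<in>Obj \<N>. \<forall>f\<in>Hom \<N> (fob (ladj ?J) k) n.
         far (radj ?J') (far N f \<cdot>\<^bsub>\<N>'\<^esub> (\<lambda>k\<in>Obj \<K>. lam (k, m)) k) \<cdot>\<^bsub>\<K>'\<^esub> unit ?J' (fob K k) =
         (\<lambda>n\<in>Obj \<N>. \<rho>r (m, n)) n \<cdot>\<^bsub>\<K>'\<^esub> far K (far (radj ?J) f \<cdot>\<^bsub>\<K>\<^esub> unit ?J k))"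
      by (rule mates_iff_transpose[OF X.adjunction_adj_fix_M[OF m] X'.adjunction_adj_fix_M[OF m']
            K.is_functor_axioms N.is_functor_axioms])
    moreover have "far (radj ?J') (far N f \<cdot>\<^bsub>\<N>'\<^esub> lam (k, m)) \<cdot>\<^bsub>\<K>'\<^esub> unit ?J' (fob K k) =
        iso_r X' (fob K k) (fob M m) (fob N n)
          (iso_l X' (fob K k) (fob M m) (fob N n) (far N f \<cdot>\<^bsub>\<N>'\<^esub> lam (k, m)))"
      if "k \<in> Obj \<K>" "n \<in> Obj \<N>" "f \<in> Hom \<N> (fob (tensor X) (k, m)) n" for k n f
      using X'.catN.Comp_Hom[OF _ N.far_Hom[OF that(3)]] nat_trans_Hom[OF lam, of "(k, m)"] m m' that
      by (simp add: X'.transpose_adj_fix_M K.fob_Obj N.fob_Obj)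
    moreover have "fob (ladj ?J) k = fob (tensor X) (k, m)" for k
      by (simp add: adj_fix_M_def adj_of_hom_iso_def)
    ultimately show ?thesis
      using m by (simp add: X.transpose_adj_fix_M cong: ball_cong)
  qed
  then show ?thesis unfolding square_M_def by auto
qed

lemma mates_N_iff_square:
  assumes \<rho>l: "\<rho>l \<in> Rl" and \<rho>r: "\<rho>r \<in> Rr"
  shows "(\<forall>n\<in>Obj \<N>. mates \<K> (op_cat \<M>) (adj_fix_N \<K> \<M> \<N> X n)
        \<K>' (op_cat \<M>') (adj_fix_N \<K>' \<M>' \<N>' X' (fob N n)) K M
      (\<lambda>k\<in>Obj \<K>. \<rho>l (k, n)) (\<lambda>m\<in>Obj \<M>. \<rho>r (m, n))) \<longleftrightarrow> square_N \<rho>l \<rho>r"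
proof -
  have "mates \<K> (op_cat \<M>) (adj_fix_N \<K> \<M> \<N> X n)
        \<K>' (op_cat \<M>') (adj_fix_N \<K>' \<M>' \<N>' X' (fob N n)) K M
      (\<lambda>k\<in>Obj \<K>. \<rho>l (k, n)) (\<lambda>m\<in>Obj \<M>. \<rho>r (m, n)) \<longleftrightarrow>
    (\<forall>k\<in>Obj \<K>. \<forall>m\<in>Obj \<M>. \<forall>g\<in>Hom \<M> m (fob (hom_l X) (k, n)).
     iso_r X' (fob K k) (fob M m) (fob N n) (\<rho>l (k, n) \<cdot>\<^bsub>\<M>'\<^esub> far M g) =
     \<rho>r (m, n) \<cdot>\<^bsub>\<K>'\<^esub> far K (iso_r X k m n g))" if n: "n \<in> Obj \<N>" for n
  proof -
    let ?J = "adj_fix_N \<K> \<M> \<N> X n" and ?J' = "adj_fix_N \<K>' \<M>' \<N>' X' (fob N n)"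
    note n' = N.fob_Obj[OF n]
    have "(\<lambda>k\<in>Obj \<K>. \<rho>l (k, n)) \<in> nat_trans \<K> (op_cat \<M>') (ladj ?J' \<odot> K) (M \<odot> ladj ?J)"
      using nat_trans_fix_snd[OF X.catN.category_axioms \<rho>l n] nat_trans_op[of "op_cat \<K>" \<M>']
      by (simp add: adj_fix_N_def adj_of_hom_iso_def fix_snd_def comp_fnctr_def prod_fnctr_def
          comp_def N.far_Ident[OF n])
    moreover have "(\<lambda>m\<in>Obj \<M>. \<rho>r (m, n)) \<in> nat_trans (op_cat \<M>) \<K>' (K \<odot> radj ?J) (radj ?J' \<odot> M)"
      using nat_trans_fix_snd[OF X.catN.category_axioms \<rho>r n]
      by (simp add: adj_fix_N_def adj_of_hom_iso_def fix_snd_def comp_fnctr_def prod_fnctr_def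
          comp_def N.far_Ident[OF n])
    ultimately have "mates \<K> (op_cat \<M>) ?J \<K>' (op_cat \<M>') ?J' K M
        (\<lambda>k\<in>Obj \<K>. \<rho>l (k, n)) (\<lambda>m\<in>Obj \<M>. \<rho>r (m, n)) \<longleftrightarrow>
      (\<forall>k\<in>Obj \<K>. \<forall>m\<in>Obj (op_cat \<M>). \<forall>g\<in>Hom (op_cat \<M>) (fob (ladj ?J) k) m.
         far (radj ?J') (far M g \<cdot>\<^bsub>op_cat \<M>'\<^esub> (\<lambda>k\<in>Obj \<K>. \<rho>l (k, n)) k) \<cdot>\<^bsub>\<K>'\<^esub> unit ?J' (fob K k) =
         (\<lambda>m\<in>Obj \<M>. \<rho>r (m, n)) m \<cdot>\<^bsub>\<K>'\<^esub> far K (far (radj ?J) g \<cdot>\<^bsub>\<K>\<^esub> unit ?J k))"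
      by (rule mates_iff_transpose[OF X.adjunction_adj_fix_N[OF n] X'.adjunction_adj_fix_N[OF n']
            K.is_functor_axioms is_functor_op[OF M.is_functor_axioms]])
    moreover have "far (radj ?J') (\<rho>l (k, n) \<cdot>\<^bsub>\<M>'\<^esub> far M g) \<cdot>\<^bsub>\<K>'\<^esub> unit ?J' (fob K k) =
        iso_r X' (fob K k) (fob M m) (fob N n) (\<rho>l (k, n) \<cdot>\<^bsub>\<M>'\<^esub> far M g)"
      if "k \<in> Obj \<K>" "m \<in> Obj \<M>" "g \<in> Hom \<M> m (fob (hom_l X) (k, n))" for k m g
      using X'.catM.Comp_Hom[OF M.far_Hom[OF that(3)]] nat_trans_Hom[OF \<rho>l, of "(k, n)"] n n' that
      by (simp add: X'.transpose_adj_fix_N K.fob_Obj M.fob_Obj)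
    moreover have "fob (ladj ?J) k = fob (hom_l X) (k, n)" for k
      by (simp add: adj_fix_N_def adj_of_hom_iso_def)
    ultimately show ?thesis
      using n by (simp add: X.transpose_adj_fix_N cong: ball_cong)
  qed
  then show ?thesis unfolding square_N_def by auto
qed

end

theorem lemma2p12:
  fixes \<K> :: "('ko, 'ka) cat" and \<M> :: "('mo, 'ma) cat" and \<N> :: "('no, 'na) cat"
    and \<K>' :: "('ko', 'ka') cat" and \<M>' :: "('mo', 'ma') cat" and \<N>' :: "('no', 'na') cat"
    and X :: "('ko, 'ka, 'mo, 'ma, 'no, 'na) two_var_adj"
    and X' :: "('ko', 'ka', 'mo', 'ma', 'no', 'na') two_var_adj"
    and K :: "('ko, 'ka, 'ko', 'ka') fnctr"
    and M :: "('mo, 'ma, 'mo', 'ma') fnctr"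
    and N :: "('no, 'na, 'no', 'na') fnctr"
  assumes X: "two_variable_adjunction \<K> \<M> \<N> X"
    and X': "two_variable_adjunction \<K>' \<M>' \<N>' X'"
    and K: "is_functor \<K> \<K>' K" and M: "is_functor \<M> \<M>' M" and N: "is_functor \<N> \<N>' N"
  defines "Lam \<equiv> nat_trans (prod_cat \<K> \<M>) \<N>'
      (tensor X' \<odot> prod_fnctr K M) (N \<odot> tensor X)"
    and "Rl \<equiv> nat_trans (prod_cat (op_cat \<K>) \<N>) \<M>'
      (M \<odot> hom_l X) (hom_l X' \<odot> prod_fnctr K N)"
    and "Rr \<equiv> nat_trans (prod_cat (op_cat \<M>) \<N>) \<K>'
      (K \<odot> hom_r X) (hom_r X' \<odot> prod_fnctr M N)"
    and "mates_K \<equiv> \<lambda>lam \<rho>l. \<forall>k\<in>Obj \<K>.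
      mates \<M> \<N> (adj_fix_K \<K> \<M> \<N> X k) \<M>' \<N>' (adj_fix_K \<K>' \<M>' \<N>' X' (fob K k)) M N
        (\<lambda>m\<in>Obj \<M>. lam (k, m)) (\<lambda>n\<in>Obj \<N>. \<rho>l (k, n))"
    and "mates_M \<equiv> \<lambda>lam \<rho>r. \<forall>m\<in>Obj \<M>.
      mates \<K> \<N> (adj_fix_M \<K> \<M> \<N> X m) \<K>' \<N>' (adj_fix_M \<K>' \<M>' \<N>' X' (fob M m)) K N
        (\<lambda>k\<in>Obj \<K>. lam (k, m)) (\<lambda>n\<in>Obj \<N>. \<rho>r (m, n))"
    and "mates_N \<equiv> \<lambda>\<rho>l \<rho>r. \<forall>n\<in>Obj \<N>.
      mates \<K> (op_cat \<M>) (adj_fix_N \<K> \<M> \<N> X n)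
        \<K>' (op_cat \<M>') (adj_fix_N \<K>' \<M>' \<N>' X' (fob N n)) K M
        (\<lambda>k\<in>Obj \<K>. \<rho>l (k, n)) (\<lambda>m\<in>Obj \<M>. \<rho>r (m, n))"
  shows "\<exists>\<Phi>l \<Phi>r \<Psi>.
    bij_betw \<Phi>l Lam Rl \<and> (\<forall>lam\<in>Lam. \<forall>\<rho>l\<in>Rl. \<Phi>l lam = \<rho>l \<longleftrightarrow> mates_K lam \<rho>l) \<and>
    bij_betw \<Phi>r Lam Rr \<and> (\<forall>lam\<in>Lam. \<forall>\<rho>r\<in>Rr. \<Phi>r lam = \<rho>r \<longleftrightarrow> mates_M lam \<rho>r) \<and>
    bij_betw \<Psi> Rl Rr \<and> (\<forall>\<rho>l\<in>Rl. \<forall>\<rho>r\<in>Rr. \<Psi> \<rho>l = \<rho>r \<longleftrightarrow> mates_N \<rho>l \<rho>r) \<and>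
    (\<forall>lam\<in>Lam. \<Psi> (\<Phi>l lam) = \<Phi>r lam)"
proof -
  interpret two_variable_mates \<K> \<M> \<N> \<K>' \<M>' \<N>' X X' K M N
    by (intro two_variable_mates.intro X X' K M N)
  obtain \<Phi> where \<Phi>: "bij_betw \<Phi> Lam Rl"
      "\<And>lam \<rho>l. \<lbrakk>lam \<in> Lam; \<rho>l \<in> Rl\<rbrakk> \<Longrightarrow> \<Phi> lam = \<rho>l \<longleftrightarrow> square_K lam \<rho>l"
    using square_K_bijection unfolding Lam_def Rl_def by blast
  obtain \<Psi> where \<Psi>: "bij_betw \<Psi> Rl Rr"
      "\<And>\<rho>l \<rho>r. \<lbrakk>\<rho>l \<in> Rl; \<rho>r \<in> Rr\<rbrakk> \<Longrightarrow> \<Psi> \<rho>l = \<rho>r \<longleftrightarrow> square_N \<rho>l \<rho>r"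
    using square_N_bijection unfolding Rl_def Rr_def by blast
  have \<Psi>\<Phi>: "(\<Psi> \<circ> \<Phi>) lam = \<rho>r \<longleftrightarrow> square_M lam \<rho>r" if "lam \<in> Lam" "\<rho>r \<in> Rr" for lam \<rho>r
  proof -
    have \<Phi>lam: "\<Phi> lam \<in> Rl" by (rule bij_betw_apply[OF \<Phi>(1) that(1)])
    then have "square_K lam (\<Phi> lam)" using \<Phi>(2)[OF that(1)] by blast
    then show ?thesis using square_M_iff_square_N \<Psi>(2)[OF \<Phi>lam that(2)] by simp
  qed
  have "mates_K lam \<rho>l \<longleftrightarrow> square_K lam \<rho>l" if "lam \<in> Lam" "\<rho>l \<in> Rl" for lam \<rho>l
    using mates_K_iff_square that unfolding mates_K_def Lam_def Rl_def by blast
  moreover have "mates_M lam \<rho>r \<longleftrightarrow> square_M lam \<rho>r" if "lam \<in> Lam" "\<rho>r \<in> Rr" for lam \<rho>r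
    using mates_M_iff_square that unfolding mates_M_def Lam_def Rr_def by blast
  moreover have "mates_N \<rho>l \<rho>r \<longleftrightarrow> square_N \<rho>l \<rho>r" if "\<rho>l \<in> Rl" "\<rho>r \<in> Rr" for \<rho>l \<rho>r
    using mates_N_iff_square that unfolding mates_N_def Rl_def Rr_def by blast
  ultimately show ?thesis
    using \<Phi> \<Psi> \<Psi>\<Phi> bij_betw_trans[OF \<Phi>(1) \<Psi>(1)]
    by (intro exI[of _ \<Phi>] exI[of _ "\<Psi> \<circ> \<Phi>"] exI[of _ \<Psi>]) simp
qed

end
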